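(* Let $Q=(q_n)$ and $S=(s_n)$ be basic sequences with $Q$ infinite in limit, and let $(Q_j)_{j=1}^\infty$ be the basic sequences determined by $Q_1=Q$ and $Q_j\sim_{s_j}Q_{j+1}$ for all $j\ge1$. Then $$\Theta_{Q,S}\subsetneq\bigcap_{j=1}^\infty\mathscr{DN}(Q_j)\setminus\mathscr{RN}_1(Q_j).$$
   Context: A basic sequence is a sequence $Q=(q_n)_{n=1}^\infty$ of integers $q_n\ge 2$; it is infinite in limit if $q_n\to\infty$. For basic sequences $P=(p_n)$, $Q=(q_n)$ and a positive integer $s$, $P\sim_s Q$ means $q_n=\prod_{j=1}^s p_{s(n-1)+j}$ for all $n$. The $Q$-Cantor series expansion of $x\in\mathbb R$ is the unique expansion $x=\lfloor x\rfloor+\sum_{n=1}^\infty \frac{E_n}{q_1q_2\cdots q_n}$ with $E_n\in\{0,1,\dots,q_n-1\}$ for $n\ge1$ and $E_n\ne q_n-1$ for infinitely many $n$. For a block (finite sequence) $B$ of non-negative integers, $N_n^Q(B,x)$ is the number of times $B$ occurs in $(E_1,E_2,\dots)$ starting at a position no greater than $n$. $\mathscr{RN}_1(Q)$ is the set of real $x$ such that for all blocks $B_1,B_2$ of length $1$, $\lim_{n\to\infty} N_n^Q(B_1,x)/N_n^Q(B_2,x)=1$. With $T_{Q,n}(x)=\left(\prod_{j=1}^n q_j\right)x \pmod 1$, $\mathscr{DN}(Q)$ is the set of real $x$ such that $(T_{Q,n}(x))_{n=0}^\infty$ is uniformly distributed mod $1$. Construction of $\Theta_{Q,S}$. Empty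 products are $1$ and empty sums are $0$. Let $S_j=\prod_{k=1}^{j-1}s_k$ (so $S_1=1$), and let $\nu_j$ be the least positive integer $t$ such that $q_m\ge S_j^{2j}$ for all $m\ge t$. Put $l_1=s_1\nu_2$, $L_0=0$, $L_j=\sum_{k=1}^j S_kl_k$, and for $j\ge2$ recursively $$l_j=\frac{L_{j-1}\,(2js_j\nu_{j+1}-1)}{S_j}$$ (these are positive integers). Let $\mathscr U=\{(j,b,c)\in\mathbb N^3: b\le l_j,\ c\le S_j\}$ with $\mathbb N=\{1,2,\dots\}$, and $\phi(j,b,c)=L_{j-1}+(b-1)S_j+c$, which is a bijection $\mathscr U\to\mathbb N$. Let $\mathscr F$ be the set of all families $F=(F_{(j,b,c)})_{(j,b,c)\in\mathscr U}$ of positive integers such that $F_{(j,b,c)}/q_{\phi(j,b,c)}\in V_{j,b,c}$ for all $(j,b,c)\in\mathscr U$, where $$V_{1,b,c}=\left[\frac{1}{q_{\phi(1,b,c)}},\frac{2}{q_{\phi(1,b,c)}}\right),\qquad V_{j,b,c}=\left[\frac{c}{S_j}+\frac1{S_j^2},\ \frac{c}{S_j}+\frac{2}{S_j^2}\right]\ \text{ for } j>1.$$ For $F\in\mathscr F$ put $E_{F,n}=F_{\phi^{-1}(n)}$ and let $x_F$ be the sum of the series $x_F=\sum_{n=1}^\infty\frac{E_{F,n}}{q_1q_2\cdots q_n}$. Then $\Theta_{Q,S}=\{x_F:F\in\mathscr F\}$. *)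

theory Defs
  imports Complex_Main
begin

text \<open>
  Sequences indexed by the positive integers are functions on \<^typ>\<open>nat\<close> whose value
  at \<open>0\<close> is never used.
\<close>

definition basic_seq :: "(nat \<Rightarrow> nat) \<Rightarrow> bool" where
  "basic_seq Q \<longleftrightarrow> (\<forall>n\<ge>1. Q n \<ge> 2)"

definition infinite_in_limit :: "(nat \<Rightarrow> nat) \<Rightarrow> bool" where
  "infinite_in_limit Q \<longleftrightarrow> filterlim Q at_top sequentially"

text \<open>\<open>base_sim s P Q\<close> is the relation $P \sim_s Q$.\<close>

definition base_sim :: "nat \<Rightarrow> (nat \<Rightarrow> nat) \<Rightarrow> (nat \<Rightarrow> nat) \<Rightarrow> bool" where
  "base_sim s P Q \<longleftrightarrow> (\<forall>n\<ge>1. Q n = (\<Prod>j=1..s. P (s * (n - 1) + j)))"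

text \<open>
  The condition \<open>E 0 = 0\<close> only normalises the unused value, so that the digit
  sequence is unique as a function on \<^typ>\<open>nat\<close>.
\<close>

definition is_cantor_expansion :: "(nat \<Rightarrow> nat) \<Rightarrow> real \<Rightarrow> (nat \<Rightarrow> nat) \<Rightarrow> bool" where
  "is_cantor_expansion Q x E \<longleftrightarrow>
     E 0 = 0 \<and>
     (\<forall>n\<ge>1. E n \<le> Q n - 1) \<and>
     infinite {n. n \<ge> 1 \<and> E n \<noteq> Q n - 1} \<and>
     (\<lambda>n. real (E (Suc n)) / real (\<Prod>j=1..Suc n. Q j)) sums (x - of_int \<lfloor>x\<rfloor>)"

definition cantor_digits :: "(nat \<Rightarrow> nat) \<Rightarrow> real \<Rightarrow> nat \<Rightarrow> nat" where
  "cantor_digits Q x = (THE E. is_cantor_expansion Q x E)"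

definition block_count :: "(nat \<Rightarrow> nat) \<Rightarrow> nat \<Rightarrow> nat list \<Rightarrow> real \<Rightarrow> nat" where
  "block_count Q n B x =
     card {i \<in> {1..n}. \<forall>k<length B. cantor_digits Q x (i + k) = B ! k}"

text \<open>
  A quotient with denominator \<open>0\<close> has value \<open>0\<close>, so the limit below can be \<open>1\<close> only if
  the denominators are eventually nonzero.
\<close>

definition RN1 :: "(nat \<Rightarrow> nat) \<Rightarrow> real set" where
  "RN1 Q = {x. \<forall>B1 B2. length B1 = 1 \<longrightarrow> length B2 = 1 \<longrightarrow>
     (\<lambda>n. real (block_count Q n B1 x) / real (block_count Q n B2 x)) \<longlonglongrightarrow> 1}"

definition cantor_T :: "(nat \<Rightarrow> nat) \<Rightarrow> nat \<Rightarrow> real \<Rightarrow> real" where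
  "cantor_T Q n x = frac (real (\<Prod>j=1..n. Q j) * x)"

definition uniformly_distributed_mod1 :: "(nat \<Rightarrow> real) \<Rightarrow> bool" where
  "uniformly_distributed_mod1 u \<longleftrightarrow>
     (\<forall>a b. 0 \<le> a \<and> a < b \<and> b \<le> 1 \<longrightarrow>
        (\<lambda>N. real (card {n \<in> {..<N}. frac (u n) \<in> {a..<b}}) / real N) \<longlonglongrightarrow> b - a)"

definition DN :: "(nat \<Rightarrow> nat) \<Rightarrow> real set" where
  "DN Q = {x. uniformly_distributed_mod1 (\<lambda>n. cantor_T Q n x)}"

text \<open>Below, \<open>Q\<close> and \<open>s\<close> are the two basic sequences from which $\Theta_{Q,S}$ is built.\<close>

definition theta_S :: "(nat \<Rightarrow> nat) \<Rightarrow> nat \<Rightarrow> nat" where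
  "theta_S s j = (\<Prod>k=1..<j. s k)"

definition theta_nu :: "(nat \<Rightarrow> nat) \<Rightarrow> (nat \<Rightarrow> nat) \<Rightarrow> nat \<Rightarrow> nat" where
  "theta_nu Q s j = (LEAST t. t \<ge> 1 \<and> (\<forall>m\<ge>t. Q m \<ge> theta_S s j ^ (2 * j)))"

text \<open>
  The sum is $L_{j-1}$ for $j = n + 2$. If \<open>Q\<close> and \<open>s\<close> are basic and \<open>Q\<close> is infinite in
  limit, then \<open>theta_nu\<close> is positive and induction gives
  $L_j = L_{j-1} \cdot 2 j s_j \nu_{j+1}$ for $j \ge 2$ and $S_{j+1} \mid L_j$, so neither
  the subtraction nor the division truncates. The value at \<open>0\<close> is not used.
\<close>

fun theta_l :: "(nat \<Rightarrow> nat) \<Rightarrow> (nat \<Rightarrow> nat) \<Rightarrow> nat \<Rightarrow> nat" where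
  "theta_l Q s 0 = 0"
| "theta_l Q s (Suc 0) = s 1 * theta_nu Q s 2"
| "theta_l Q s (Suc (Suc n)) =
     (\<Sum>k=1..Suc n. theta_S s k * theta_l Q s k)
       * (2 * (n + 2) * s (n + 2) * theta_nu Q s (n + 3) - 1) div theta_S s (n + 2)"

definition theta_L :: "(nat \<Rightarrow> nat) \<Rightarrow> (nat \<Rightarrow> nat) \<Rightarrow> nat \<Rightarrow> nat" where
  "theta_L Q s j = (\<Sum>k=1..j. theta_S s k * theta_l Q s k)"

definition theta_U :: "(nat \<Rightarrow> nat) \<Rightarrow> (nat \<Rightarrow> nat) \<Rightarrow> (nat \<times> nat \<times> nat) set" where
  "theta_U Q s = {(j, b, c). j \<ge> 1 \<and> b \<ge> 1 \<and> c \<ge> 1 \<and> b \<le> theta_l Q s j \<and> c \<le> theta_S s j}"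

definition theta_phi :: "(nat \<Rightarrow> nat) \<Rightarrow> (nat \<Rightarrow> nat) \<Rightarrow> nat \<times> nat \<times> nat \<Rightarrow> nat" where
  "theta_phi Q s = (\<lambda>(j, b, c). theta_L Q s (j - 1) + (b - 1) * theta_S s j + c)"

definition theta_V :: "(nat \<Rightarrow> nat) \<Rightarrow> (nat \<Rightarrow> nat) \<Rightarrow> nat \<times> nat \<times> nat \<Rightarrow> real set" where
  "theta_V Q s = (\<lambda>(j, b, c).
     if j = 1 then {1 / real (Q (theta_phi Q s (j, b, c))) ..< 2 / real (Q (theta_phi Q s (j, b, c)))}
     else {real c / real (theta_S s j) + 1 / real (theta_S s j) ^ 2 ..
           real c / real (theta_S s j) + 2 / real (theta_S s j) ^ 2})"

text \<open>Only the values of a family on \<open>theta_U Q s\<close> are constrained or used.\<close>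

definition theta_F :: "(nat \<Rightarrow> nat) \<Rightarrow> (nat \<Rightarrow> nat) \<Rightarrow> (nat \<times> nat \<times> nat \<Rightarrow> nat) set" where
  "theta_F Q s = {F. \<forall>u \<in> theta_U Q s.
     F u \<ge> 1 \<and> real (F u) / real (Q (theta_phi Q s u)) \<in> theta_V Q s u}"

definition theta_E ::
    "(nat \<Rightarrow> nat) \<Rightarrow> (nat \<Rightarrow> nat) \<Rightarrow> (nat \<times> nat \<times> nat \<Rightarrow> nat) \<Rightarrow> nat \<Rightarrow> nat" where
  "theta_E Q s F n = F (inv_into (theta_U Q s) (theta_phi Q s) n)"

text \<open>
  For $c = S_j$ and $j > 1$ the numerator \<open>theta_E Q s F n\<close> exceeds \<open>Q n\<close>, so the series
  below need not be the Cantor series expansion of its sum.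
\<close>

definition theta_x ::
    "(nat \<Rightarrow> nat) \<Rightarrow> (nat \<Rightarrow> nat) \<Rightarrow> (nat \<times> nat \<times> nat \<Rightarrow> nat) \<Rightarrow> real" where
  "theta_x Q s F = (\<Sum>n. real (theta_E Q s F (Suc n)) / real (\<Prod>j=1..Suc n. Q j))"

definition Theta :: "(nat \<Rightarrow> nat) \<Rightarrow> (nat \<Rightarrow> nat) \<Rightarrow> real set" where
  "Theta Q s = theta_x Q s ` theta_F Q s"

end

theory Submission
  imports Defs
begin

text \<open>
  Write $T_i = T_{Q,i}(x)$ for a point $x$ of $\Theta_{Q,S}$, so that $T_{Q_k,n}(x) = T_{S_k n}$.
  On the level $L_{j-1} \le i < L_j$ with $S_j \ge 3$ the rescaled tail of the series lies in a short
  interval just to the right of $c/S_j$, where $c \equiv i + 1$ modulo $S_j$; hence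
  $\lfloor S_j T_i \rfloor = (i + 1) \bmod S_j$. With $R = S_j / S_k$ it follows that
  $\lfloor R\, T_{S_k n} \rfloor$ runs through all residues modulo $R$ when $n$ runs through $R$ consecutive
  integers on this level. Since $R \to \infty$ and $S_j / L_{j-1} \to 0$, this gives uniform distribution.

  The same description shows that the digit $3$ never occurs in the $Q_1$-expansion and the digit $0$
  never occurs in the $Q_k$-expansion for $k \ge 2$, so $x \notin \mathscr{RN}_1(Q_k)$.

  The right-hand side is invariant under integer translations while $\Theta_{Q,S}$ is nonempty and
  bounded, so the inclusion is proper.
\<close>

section \<open>Cantor series and their digits\<close>

definition base_prod :: "(nat \<Rightarrow> nat) \<Rightarrow> nat \<Rightarrow> nat" where
  "base_prod Q n = (\<Prod>j=1..n. Q j)"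

lemma base_prod_0 [simp]: "base_prod Q 0 = 1"
  by (simp add: base_prod_def)

lemma base_prod_Suc [simp]: "base_prod Q (Suc n) = base_prod Q n * Q (Suc n)"
  by (simp add: base_prod_def)

lemma basic_seq_Suc: "basic_seq Q \<Longrightarrow> 2 \<le> Q (Suc n)"
  by (simp add: basic_seq_def)

lemma base_prod_ge_power: "basic_seq Q \<Longrightarrow> 2 ^ n \<le> base_prod Q n"
proof (induction n)
  case (Suc n)
  then show ?case
    using mult_mono[of "2 ^ n" "base_prod Q n" 2 "Q (Suc n)"] basic_seq_Suc[of Q n]
    by (simp add: mult.commute)
qed simp

lemma base_prod_pos: "basic_seq Q \<Longrightarrow> 0 < base_prod Q n"
  by (rule less_le_trans[OF _ base_prod_ge_power]) simp_all

lemma base_prod_mono: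
  assumes "basic_seq Q" "m \<le> n"
  shows "base_prod Q m \<le> base_prod Q n"
  using assms(2)
proof (induction rule: dec_induct)
  case (step n)
  then show ?case
    using basic_seq_Suc[OF assms(1), of n] mult_le_mono[of "base_prod Q m" "base_prod Q n" 1 "Q (Suc n)"]
    by simp
qed simp

text \<open>When \<open>x\<close> is the sum of the series, this is the remainder after
  \<open>n\<close> terms, rescaled by the product of the first \<open>n\<close> bases. The
  numerators \<open>E\<close> are arbitrary, so it may exceed 1.\<close>

definition cantor_tail :: "(nat \<Rightarrow> nat) \<Rightarrow> (nat \<Rightarrow> nat) \<Rightarrow> real \<Rightarrow> nat \<Rightarrow> real" where
  "cantor_tail Q E x n =
     real (base_prod Q n) * (x - (\<Sum>m<n. real (E (Suc m)) / real (base_prod Q (Suc m))))"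

lemma cantor_tail_0 [simp]: "cantor_tail Q E x 0 = x"
  by (simp add: cantor_tail_def)

lemma cantor_tail_Suc:
  assumes "basic_seq Q"
  shows "cantor_tail Q E x (Suc n) = real (Q (Suc n)) * cantor_tail Q E x n - real (E (Suc n))"
proof -
  have "real (base_prod Q n) > 0" "real (Q (Suc n)) > 0"
    using base_prod_pos[OF assms, of n] basic_seq_Suc[OF assms, of n] by simp_all
  then show ?thesis
    by (simp add: cantor_tail_def field_simps)
qed

lemma frac_add_of_int: "frac (x + of_int k) = frac (x::real)"
  by (simp add: frac_def)

lemma cantor_T_eq: "cantor_T Q n x = frac (real (base_prod Q n) * x)"
  by (simp only: cantor_T_def base_prod_def)

text \<open>Each step of the recursion multiplies by an integer and subtracts an integer, so the
  tail and \<open>base_prod Q n * x\<close> differ by an integer.\<close>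

lemma frac_cantor_tail:
  assumes "basic_seq Q"
  shows "frac (cantor_tail Q E x n) = cantor_T Q n x"
proof -
  have "real (base_prod Q n) * x - cantor_tail Q E x n \<in> \<int>"
  proof (induction n)
    case (Suc n)
    have "real (base_prod Q (Suc n)) * x - cantor_tail Q E x (Suc n) =
      real (Q (Suc n)) * (real (base_prod Q n) * x - cantor_tail Q E x n) + real (E (Suc n))"
      by (simp add: cantor_tail_Suc[OF assms] algebra_simps)
    then show ?case
      using Suc by simp
  qed simp
  then obtain k where "real (base_prod Q n) * x - cantor_tail Q E x n = of_int k"
    by (elim Ints_cases)
  then have "real (base_prod Q n) * x = cantor_tail Q E x n + of_int k"
    by simp
  then show ?thesis
    by (simp add: cantor_T_eq frac_add_of_int)
qed

text \<open>The hypothesis on \<open>K\<close> says that if the next tail is at most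
  \<open>K\<close>, then so is the present one. It is applied with \<open>K = 1\<close> for true
  digits and with \<open>K = 3\<close> for the numerators of \<open>Theta\<close>.\<close>

lemma cantor_partial_sum_antimono:
  assumes "basic_seq Q" and bound: "\<And>n. real (E (Suc n)) + K \<le> K * real (Q (Suc n))"
    and "m \<le> n"
  shows "(\<Sum>i<n. real (E (Suc i)) / real (base_prod Q (Suc i))) + K / real (base_prod Q n)
    \<le> (\<Sum>i<m. real (E (Suc i)) / real (base_prod Q (Suc i))) + K / real (base_prod Q m)"
  using \<open>m \<le> n\<close>
proof (induction rule: dec_induct)
  case (step n)
  have pos: "real (base_prod Q n) > 0" "real (Q (Suc n)) > 0"
    using base_prod_pos[OF assms(1), of n] basic_seq_Suc[OF assms(1), of n] by simp_all
  have "real (E (Suc n)) / real (base_prod Q (Suc n)) + K / real (base_prod Q (Suc n))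
      = (real (E (Suc n)) + K) / (real (base_prod Q n) * real (Q (Suc n)))"
    by (simp add: add_divide_distrib)
  also have "\<dots> \<le> (K * real (Q (Suc n))) / (real (base_prod Q n) * real (Q (Suc n)))"
    using pos bound[of n] by (intro divide_right_mono) auto
  also have "\<dots> = K / real (base_prod Q n)"
    using pos by simp
  finally show ?case
    using step.IH by simp
qed simp

lemma summable_cantor_series:
  assumes "basic_seq Q" and "\<And>n. real (E (Suc n)) + K \<le> K * real (Q (Suc n))" and "0 \<le> K"
  shows "summable (\<lambda>n. real (E (Suc n)) / real (base_prod Q (Suc n)))"
proof (rule bounded_imp_summable)
  fix n
  have "(\<Sum>i<Suc n. real (E (Suc i)) / real (base_prod Q (Suc i))) + K / real (base_prod Q (Suc n)) \<le> K"
    using cantor_partial_sum_antimono[OF assms(1,2), of 0 "Suc n"] by simp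
  moreover have "0 \<le> K / real (base_prod Q (Suc n))"
    using assms(3) by simp
  ultimately show "(\<Sum>i\<le>n. real (E (Suc i)) / real (base_prod Q (Suc i))) \<le> K"
    unfolding lessThan_Suc_atMost by linarith
qed simp

lemma cantor_tail_bounds:
  assumes "basic_seq Q" and "\<And>n. real (E (Suc n)) + K \<le> K * real (Q (Suc n))" and "0 \<le> K"
    and sums: "(\<lambda>n. real (E (Suc n)) / real (base_prod Q (Suc n))) sums x"
  shows "0 \<le> cantor_tail Q E x n" "cantor_tail Q E x n \<le> K"
proof -
  let ?a = "\<lambda>n. real (E (Suc n)) / real (base_prod Q (Suc n))"
  have pos: "real (base_prod Q n) > 0"
    using base_prod_pos[OF assms(1), of n] by simp
  have "sum ?a {..<n} \<le> x"
    using sums sum_le_suminf[of ?a "{..<n}"] by (auto simp: sums_iff)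
  then show "0 \<le> cantor_tail Q E x n"
    by (simp add: cantor_tail_def)
  have "x \<le> sum ?a {..<n} + K / real (base_prod Q n)"
  proof (rule LIMSEQ_le_const2)
    show "(\<lambda>n. sum ?a {..<n}) \<longlonglongrightarrow> x"
      using sums by (simp only: sums_def)
    have "sum ?a {..<m} \<le> sum ?a {..<n} + K / real (base_prod Q n)" if "m \<ge> n" for m
    proof -
      have "0 \<le> K / real (base_prod Q m)"
        using assms(3) by simp
      then show ?thesis
        using cantor_partial_sum_antimono[OF assms(1,2) that] by linarith
    qed
    then show "\<exists>N. \<forall>m\<ge>N. sum ?a {..<m} \<le> sum ?a {..<n} + K / real (base_prod Q n)"
      by blast
  qed
  then have "x - sum ?a {..<n} \<le> K / real (base_prod Q n)"
    by simp
  then show "cantor_tail Q E x n \<le> K"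
    using pos by (simp add: cantor_tail_def field_simps)
qed

text \<open>A tail equal to 1 forces a maximal next digit and again a tail equal to 1, hence maximal
  digits forever, which an expansion excludes.\<close>

lemma no_constant_tail_one:
  assumes "basic_seq Q" and inf: "infinite {n. n \<ge> 1 \<and> E n \<noteq> Q n - 1}"
    and le: "\<And>n. n \<ge> 1 \<Longrightarrow> E n \<le> Q n - 1" and "\<And>n. r n \<le> (1::real)"
    and rec: "\<And>n. r (Suc n) = real (Q (Suc n)) * r n - real (E (Suc n))"
  shows "r n < 1"
proof (rule ccontr)
  assume "\<not> r n < 1"
  then have one: "r n = 1"
    using assms(4)[of n] by simp
  have step: "r (Suc m) = 1 \<and> E (Suc m) = Q (Suc m) - 1" if "r m = 1" for m
    using rec[of m] that le[of "Suc m"] assms(4)[of "Suc m"] basic_seq_Suc[OF assms(1), of m]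
    by (auto simp: of_nat_diff)
  have "r m = 1" if "n \<le> m" for m
    using that by (induction rule: dec_induct) (use one step in auto)
  then have "E m = Q m - 1" if "m > n" for m
    using step[of "m - 1"] that by auto
  then have "{n. n \<ge> 1 \<and> E n \<noteq> Q n - 1} \<subseteq> {..n}"
    by (auto simp: not_less[symmetric])
  then show False
    using inf finite_subset by blast
qed

section \<open>Orbits under \<open>cantor_T\<close>; existence and uniqueness of the
  expansion\<close>

lemma cantor_T_range: "0 \<le> cantor_T Q n x" "cantor_T Q n x < 1"
  by (simp_all add: cantor_T_def frac_lt_1)

lemma cantor_T_0: "cantor_T Q 0 x = x - of_int \<lfloor>x\<rfloor>"
  by (simp add: cantor_T_def frac_def)

lemma cantor_T_Suc: "cantor_T Q (Suc n) x = frac (real (Q (Suc n)) * cantor_T Q n x)"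
proof -
  let ?P = "real (base_prod Q n) * x"
  have "real (Q (Suc n)) * ?P = real (Q (Suc n)) * frac ?P + of_int (int (Q (Suc n)) * \<lfloor>?P\<rfloor>)"
    by (simp add: frac_def algebra_simps)
  then have "frac (real (Q (Suc n)) * ?P) = frac (real (Q (Suc n)) * frac ?P)"
    by (simp only: frac_add_of_int)
  then show ?thesis
    by (simp add: cantor_T_eq mult_ac)
qed

text \<open>The tails of the fractional part of \<open>x\<close> lie in [0, 1), so they are the
  orbit itself, and the recursion shows each digit as an integer part. This gives uniqueness of the
  expansion.\<close>

lemma expansion_digit:
  assumes "basic_seq Q" and ex: "is_cantor_expansion Q x E"
  shows "E (Suc n) = nat \<lfloor>real (Q (Suc n)) * cantor_T Q n x\<rfloor>"
proof -
  define y where "y = x - of_int \<lfloor>x\<rfloor>"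
  define r where "r = cantor_tail Q E y"
  have le: "E n \<le> Q n - 1" if "n \<ge> 1" for n
    using ex that by (simp add: is_cantor_expansion_def)
  have "real (E (Suc n)) + 1 \<le> 1 * real (Q (Suc n))" for n
    using le[of "Suc n"] basic_seq_Suc[OF assms(1), of n] by simp
  note bounds = cantor_tail_bounds[OF assms(1) this]
  have sums: "(\<lambda>n. real (E (Suc n)) / real (base_prod Q (Suc n))) sums y"
    using ex by (simp only: is_cantor_expansion_def base_prod_def y_def)
  have r0: "0 \<le> r n" and r1: "r n \<le> 1" for n
    using bounds[OF _ sums] by (simp_all add: r_def)
  have rec: "r (Suc n) = real (Q (Suc n)) * r n - real (E (Suc n))" for n
    by (simp add: r_def cantor_tail_Suc[OF assms(1)])
  have "r n < 1" for n
    using no_constant_tail_one[OF assms(1) _ le r1 rec] ex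
    by (auto simp: is_cantor_expansion_def)
  then have fr: "frac (r n) = r n" for n
    using r0 by (simp add: frac_eq)
  have "cantor_T Q n y = cantor_T Q n x"
    by (induction n) (simp_all add: cantor_T_Suc cantor_T_0 y_def)
  then have "r n = cantor_T Q n x"
    using fr[of n] frac_cantor_tail[OF assms(1), of E y n] by (simp add: r_def)
  moreover have "real (Q (Suc n)) * r n = real (E (Suc n)) + r (Suc n)"
    using rec[of n] by simp
  moreover have "\<lfloor>real (E (Suc n)) + r (Suc n)\<rfloor> = int (E (Suc n))"
    using r0[of "Suc n"] \<open>\<And>n. r n < 1\<close>[of "Suc n"] by linarith
  ultimately show ?thesis
    by simp
qed

lemma expansion_exists:
  assumes "basic_seq Q"
  shows "\<exists>E. is_cantor_expansion Q x E"
proof -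
  define E where "E n = (if n = 0 then 0 else nat \<lfloor>real (Q n) * cantor_T Q (n - 1) x\<rfloor>)" for n
  have rE: "real (E (Suc n)) = of_int \<lfloor>real (Q (Suc n)) * cantor_T Q n x\<rfloor>" for n
    using cantor_T_range[of Q n x] by (simp add: E_def)
  have rec: "cantor_T Q (Suc n) x = real (Q (Suc n)) * cantor_T Q n x - real (E (Suc n))" for n
    by (simp add: cantor_T_Suc rE frac_def)
  have lt: "E (Suc n) < Q (Suc n)" for n
  proof -
    have "real (Q (Suc n)) * cantor_T Q n x < real (Q (Suc n)) * 1"
      using cantor_T_range[of Q n x] basic_seq_Suc[OF assms, of n] by (intro mult_strict_left_mono) auto
    then have "real (E (Suc n)) < real (Q (Suc n))"
      using rec[of n] cantor_T_range[of Q "Suc n" x] by linarith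
    then show ?thesis
      by simp
  qed
  have inf: "infinite {n. n \<ge> 1 \<and> E n \<noteq> Q n - 1}"
  proof
    assume "finite {n. n \<ge> 1 \<and> E n \<noteq> Q n - 1}"
    then obtain N where N: "\<And>n. n \<ge> 1 \<Longrightarrow> E n \<noteq> Q n - 1 \<Longrightarrow> n \<le> N"
      by (auto simp: finite_nat_set_iff_bounded_le)
    have E: "real (E (Suc n)) = real (Q (Suc n)) - 1" if "n \<ge> N" for n
    proof -
      have "E (Suc n) = Q (Suc n) - 1"
        using N[of "Suc n"] that by force
      then show ?thesis
        using basic_seq_Suc[OF assms, of n] by simp
    qed
    \<comment> \<open>While the digits are maximal, \<open>1 - T\<close> is multiplied by the
      current base at each step, so it at least doubles; but it never exceeds 1.\<close>
    have pw: "2 ^ k * (1 - cantor_T Q N x) \<le> 1 - cantor_T Q (N + k) x" for k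
    proof (induction k)
      case (Suc k)
      have "2 * (2 ^ k * (1 - cantor_T Q N x)) \<le> real (Q (Suc (N + k))) * (1 - cantor_T Q (N + k) x)"
        using Suc basic_seq_Suc[OF assms, of "N + k"] cantor_T_range[of Q N x]
        by (intro mult_mono) auto
      also have "\<dots> = 1 - cantor_T Q (N + Suc k) x"
        using rec[of "N + k"] E[of "N + k"] by (simp add: algebra_simps)
      finally show ?case
        by simp
    qed simp
    have d: "1 - cantor_T Q N x > 0"
      using cantor_T_range[of Q N x] by simp
    obtain k where "1 / (1 - cantor_T Q N x) < 2 ^ k"
      using real_arch_pow[of 2] by auto
    then have "1 < 2 ^ k * (1 - cantor_T Q N x)"
      using d by (simp add: field_simps)
    then show False
      using pw[of k] cantor_T_range[of Q "N + k" x] by linarith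
  qed
  \<comment> \<open>The exact remainder of the greedy expansion: an orbit point below 1 divided by a
    product of at least \<open>2 ^ n\<close>, so it vanishes in the limit.\<close>
  have partial: "(\<Sum>i<n. real (E (Suc i)) / real (base_prod Q (Suc i)))
      = (x - of_int \<lfloor>x\<rfloor>) - cantor_T Q n x / real (base_prod Q n)" for n
  proof (induction n)
    case 0
    then show ?case by (simp add: cantor_T_0)
  next
    case (Suc n)
    have "real (base_prod Q n) > 0" "real (Q (Suc n)) > 0"
      using base_prod_pos[OF assms, of n] basic_seq_Suc[OF assms, of n] by simp_all
    then have "cantor_T Q (Suc n) x / real (base_prod Q (Suc n)) =
        cantor_T Q n x / real (base_prod Q n) - real (E (Suc n)) / real (base_prod Q (Suc n))"
      by (simp add: rec field_simps)
    then show ?case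
      using Suc by simp
  qed
  have "(\<lambda>n. cantor_T Q n x / real (base_prod Q n)) \<longlonglongrightarrow> 0"
  proof (rule tendsto_sandwich)
    show "\<forall>\<^sub>F n in sequentially. 0 \<le> cantor_T Q n x / real (base_prod Q n)"
      using cantor_T_range by simp
    have "cantor_T Q n x / real (base_prod Q n) \<le> (1/2) ^ n" for n
    proof -
      have "real (2 ^ n) \<le> real (base_prod Q n)"
        using base_prod_ge_power[OF assms] of_nat_le_iff by blast
      then have "cantor_T Q n x / real (base_prod Q n) \<le> 1 / 2 ^ n"
        using cantor_T_range[of Q n x] by (intro frac_le) auto
      then show ?thesis by (simp add: power_divide)
    qed
    then show "\<forall>\<^sub>F n in sequentially. cantor_T Q n x / real (base_prod Q n) \<le> (1/2) ^ n"
      by simp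
  qed (auto intro: LIMSEQ_power_zero)
  then have "(\<lambda>n. real (E (Suc n)) / real (base_prod Q (Suc n))) sums (x - of_int \<lfloor>x\<rfloor>)"
    unfolding sums_def partial using tendsto_diff[OF tendsto_const] by fastforce
  moreover have "E n \<le> Q n - 1" if "n \<ge> 1" for n
    using lt[of "n - 1"] that by simp
  moreover have "E 0 = 0"
    by (simp add: E_def)
  ultimately have "is_cantor_expansion Q x E"
    using inf unfolding is_cantor_expansion_def base_prod_def by blast
  then show ?thesis
    by blast
qed

lemma cantor_digits_Suc:
  assumes "basic_seq Q"
  shows "cantor_digits Q x (Suc n) = nat \<lfloor>real (Q (Suc n)) * cantor_T Q n x\<rfloor>"
proof -
  obtain E where E: "is_cantor_expansion Q x E"
    using expansion_exists[OF assms] by blast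
  have "E' = E" if "is_cantor_expansion Q x E'" for E'
  proof
    fix n
    show "E' n = E n"
      using expansion_digit[OF assms that] expansion_digit[OF assms E] that E
      by (cases n) (auto simp: is_cantor_expansion_def)
  qed
  then have "cantor_digits Q x = E"
    unfolding cantor_digits_def using E by (intro the_equality) blast+
  then show ?thesis
    using expansion_digit[OF assms E] by simp
qed

text \<open>With both blocks equal to \<open>[d]\<close> all counts are 0, and the convention 0 / 0
  = 0 makes the quotient constantly 0.\<close>

lemma missing_digit_not_RN1:
  assumes "\<And>n. cantor_digits Q x (Suc n) \<noteq> d"
  shows "x \<notin> RN1 Q"
proof
  assume "x \<in> RN1 Q"
  then have "(\<lambda>n. real (block_count Q n [d] x) / real (block_count Q n [d] x)) \<longlonglongrightarrow> 1"
    unfolding RN1_def mem_Collect_eq by (elim allE[of _ "[d]"] impE) simp_all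
  moreover have "block_count Q n [d] x = 0" for n
  proof -
    have "{i \<in> {1..n}. \<forall>k<length [d]. cantor_digits Q x (i + k) = [d] ! k} = {}"
      using assms by (auto dest!: Suc_le_D)
    then show ?thesis
      by (simp add: block_count_def)
  qed
  ultimately show False
    by (simp add: LIMSEQ_const_iff)
qed

lemma cantor_T_add_nat: "cantor_T Q n (x + real k) = cantor_T Q n x"
proof -
  have "real (base_prod Q n) * (x + real k) = real (base_prod Q n) * x + of_int (int (base_prod Q n * k))"
    by (simp add: algebra_simps)
  then show ?thesis
    by (simp only: cantor_T_eq frac_add_of_int)
qed

section \<open>Uniform distribution from equidistributed blocks\<close>

text \<open>Over \<open>R\<close> consecutive indices the residues \<open>(i + d) mod R\<close> take
  each value once. With \<open>k\<close> the integer part of \<open>R * b\<close>, residues below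
  \<open>k\<close> force \<open>y i < b\<close> and residues above \<open>k\<close> exclude it; only
  the residue \<open>k\<close> is undecided.\<close>

lemma card_block_less:
  fixes y :: "nat \<Rightarrow> real" and b :: real
  assumes b: "0 \<le> b" "b \<le> 1" and "0 < R"
    and floor: "\<And>i. n \<le> i \<Longrightarrow> i < n + R \<Longrightarrow> \<lfloor>real R * y i\<rfloor> = int ((i + d) mod R)"
  shows "\<bar>real (card {i\<in>{n..<n + R}. y i < b}) - b * real R\<bar> \<le> 1"
proof -
  define k where "k = nat \<lfloor>real R * b\<rfloor>"
  define h where "h i = (i + d) mod R" for i
  have "0 \<le> real R * b"
    using b by simp
  then have k: "real k \<le> real R * b" "real R * b < real k + 1"
    unfolding k_def by linarith+
  have "real R * b \<le> real R * 1"
    using b by (intro mult_left_mono) auto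
  with k have kR: "k \<le> R"
    by simp
  have inj: "inj_on h {n..<n + R}"
  proof (rule inj_onI)
    have *: "i = j" if "i \<le> j" "n \<le> i" "j < n + R" "h i = h j" for i j
    proof -
      have "R dvd (j + d) - (i + d)"
        using that unfolding h_def by (intro mod_eq_dvd_iff_nat[THEN iffD1]) auto
      then show ?thesis
        using that by (auto dest: dvd_imp_le)
    qed
    fix i j
    assume "i \<in> {n..<n + R}" "j \<in> {n..<n + R}" "h i = h j"
    then show "i = j"
      using *[of i j] *[of j i] by (cases "i \<le> j") auto
  qed
  have img: "h ` {n..<n + R} = {..<R}"
  proof (rule card_subset_eq)
    show "h ` {n..<n + R} \<subseteq> {..<R}"
      using \<open>0 < R\<close> by (auto simp: h_def)
    show "card (h ` {n..<n + R}) = card {..<R}"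
      using card_image[OF inj] by simp
  qed simp
  have cnt: "card {i\<in>{n..<n + R}. h i < m} = m" if "m \<le> R" for m
  proof -
    have "h ` {i\<in>{n..<n + R}. h i < m} = {..<m}"
    proof
      show "{..<m} \<subseteq> h ` {i\<in>{n..<n + R}. h i < m}"
      proof
        fix a assume "a \<in> {..<m}"
        then have "a < m" "a \<in> h ` {n..<n + R}"
          unfolding img using that by auto
        then show "a \<in> h ` {i\<in>{n..<n + R}. h i < m}"
          by blast
      qed
    qed auto
    moreover have "inj_on h {i\<in>{n..<n + R}. h i < m}"
      using inj by (rule inj_on_subset) auto
    ultimately show ?thesis
      by (metis (no_types, lifting) card_image card_lessThan)
  qed
  have hy: "real (h i) \<le> real R * y i" "real R * y i < real (h i) + 1" if "i \<in> {n..<n + R}" for i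
    using floor[of i] that by (auto simp: h_def floor_eq_iff)
  have "{i\<in>{n..<n + R}. h i < k} \<subseteq> {i\<in>{n..<n + R}. y i < b}"
  proof safe
    fix i assume i: "i \<in> {n..<n + R}" and "h i < k"
    then have "real R * y i < real R * b"
      using hy[OF i] k by linarith
    then show "y i < b"
      using \<open>0 < R\<close> by simp
  qed
  then have "k \<le> card {i\<in>{n..<n + R}. y i < b}"
    using card_mono[of "{i\<in>{n..<n + R}. y i < b}" "{i\<in>{n..<n + R}. h i < k}"] cnt[OF kR]
    by (simp only: finite_atLeastLessThan finite_Collect_conjI Collect_mem_eq simp_thms)
  \<comment> \<open>The minimum covers \<open>b = 1\<close>, where \<open>k = R\<close> and no
    further residue exists.\<close>
  moreover have "{i\<in>{n..<n + R}. y i < b} \<subseteq> {i\<in>{n..<n + R}. h i < min R (Suc k)}"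
  proof safe
    fix i assume i: "i \<in> {n..<n + R}" and "y i < b"
    then have "real R * y i < real R * b"
      using \<open>0 < R\<close> by simp
    then have "real (h i) < real k + 1"
      using hy[OF i] k by linarith
    then show "h i < min R (Suc k)"
      using img i by auto
  qed
  then have "card {i\<in>{n..<n + R}. y i < b} \<le> min R (Suc k)"
    using card_mono[of "{i\<in>{n..<n + R}. h i < min R (Suc k)}" "{i\<in>{n..<n + R}. y i < b}"]
      cnt[OF min.cobounded1]
    by (simp only: finite_atLeastLessThan finite_Collect_conjI Collect_mem_eq simp_thms)
  ultimately show ?thesis
    using k by (simp add: mult.commute abs_le_iff)
qed

text \<open>\<open>D N\<close> is the counting error. A full block of length \<open>R j\<close>
  changes it by at most 1, an incomplete one by at most its length. Both are small relative to
  \<open>N\<close> because \<open>R j > j\<close> and \<open>j * R j \<le> M j\<close>; divisibility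
  splits each range from \<open>M j\<close> to \<open>M (Suc j)\<close> into full blocks.\<close>

lemma block_counting_limit:
  fixes y :: "nat \<Rightarrow> real" and M R :: "nat \<Rightarrow> nat" and b :: real
  assumes b: "0 \<le> b" "b \<le> 1" and "strict_mono M"
    and floor: "\<And>j n. M j \<le> n \<Longrightarrow> n < M (Suc j) \<Longrightarrow> \<lfloor>real (R j) * y n\<rfloor> = int ((n + d) mod R j)"
    and dvd: "\<And>j. R j dvd M j" "\<And>j. R j dvd M (Suc j)"
    and R: "\<And>j. j < R j" and M: "\<And>j. j * R j \<le> M j"
  shows "(\<lambda>N. real (card {n\<in>{..<N}. y n < b}) / real N) \<longlonglongrightarrow> b"
proof -
  define A where "A N = card {n\<in>{..<N}. y n < b}" for N
  define D where "D N = real (A N) - b * real N" for N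
  have A_add: "A (n + p) = A n + card {i\<in>{n..<n + p}. y i < b}" for n p
  proof -
    have "{i\<in>{..<n + p}. y i < b} = {i\<in>{..<n}. y i < b} \<union> {i\<in>{n..<n + p}. y i < b}"
      by auto
    moreover have "{i\<in>{..<n}. y i < b} \<inter> {i\<in>{n..<n + p}. y i < b} = {}"
      by auto
    ultimately show ?thesis
      unfolding A_def
      using card_Un_disjoint[of "{i\<in>{..<n}. y i < b}" "{i\<in>{n..<n + p}. y i < b}"]
      by (simp only: finite_lessThan finite_atLeastLessThan finite_Collect_conjI Collect_mem_eq simp_thms)
  qed
  have short: "\<bar>D (n + p) - D n\<bar> \<le> real p" for n p
  proof -
    have "card {i\<in>{n..<n + p}. y i < b} \<le> card {n..<n + p}"
      by (intro card_mono) auto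
    moreover have "0 \<le> b * real p" "b * real p \<le> 1 * real p"
      using b by (simp, intro mult_right_mono) auto
    ultimately show ?thesis
      by (simp add: D_def A_add algebra_simps abs_le_iff)
  qed
  have R0: "0 < R j" for j
    using R[of j] by simp
  have block: "\<bar>D (n + R j) - D n\<bar> \<le> 1" if "M j \<le> n" "n + R j \<le> M (Suc j)" for j n
    using card_block_less[OF b R0, of n j y d] floor[of j] that
    by (simp add: D_def A_add algebra_simps)
  have blocks: "\<bar>D (M j + t * R j) - D (M j)\<bar> \<le> real t" if "M j + t * R j \<le> M (Suc j)" for j t
    using that
  proof (induction t)
    case (Suc t)
    then have "\<bar>D (M j + t * R j + R j) - D (M j + t * R j)\<bar> \<le> 1"
      by (intro block) auto
    then show ?case
      using Suc by (simp add: algebra_simps)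
  qed simp
  have "(\<lambda>N. D N / real N) \<longlonglongrightarrow> 0"
  proof (rule LIMSEQ_I)
    fix \<epsilon> :: real
    assume "\<epsilon> > 0"
    define e where "e = \<epsilon> / 4"
    have "e > 0"
      using \<open>\<epsilon> > 0\<close> by (simp add: e_def)
    \<comment> \<open>From \<open>j0\<close> on, the error 1 of a full block is at most
      \<open>e * R j\<close>, and the length \<open>R j\<close> of a broken block is at most
      \<open>e * M j\<close>.\<close>
    obtain j0 :: nat where "1 / e < real j0"
      using reals_Archimedean2 by blast
    then have j0: "1 < e * real j0"
      using \<open>e > 0\<close> by (simp add: field_simps)
    have ej: "1 < e * real j" if "j \<ge> j0" for j
      using j0 that \<open>e > 0\<close> by (meson less_le_trans mult_left_mono of_nat_mono less_imp_le)
    have eR: "1 \<le> e * real (R j)" if "j \<ge> j0" for j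
      using ej[of "R j"] R[of j] that by simp
    have eM: "real (R j) \<le> e * real (M j)" if "j \<ge> j0" for j
    proof -
      have "real (R j) \<le> (e * real j) * real (R j)"
        using ej[OF that] R0[of j] by simp
      also have "\<dots> \<le> e * real (M j)"
        using M[of j] \<open>e > 0\<close> by (simp add: mult.assoc del: of_nat_mult flip: of_nat_mult)
      finally show ?thesis .
    qed
    define K where "K = \<bar>D (M j0)\<bar>"
    have eblocks: "\<bar>D (M j + t * R j)\<bar> \<le> \<bar>D (M j)\<bar> + e * real (t * R j)"
      if "j \<ge> j0" "M j + t * R j \<le> M (Suc j)" for j t
    proof -
      have "real t * 1 \<le> real t * (e * real (R j))"
        using eR[OF that(1)] by (intro mult_left_mono) auto
      then show ?thesis
        using blocks[OF that(2)] by (simp add: algebra_simps)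
    qed
    have atM: "\<bar>D (M j)\<bar> \<le> K + e * real (M j)" if "j \<ge> j0" for j
      using that
    proof (induction rule: dec_induct)
      case base
      then show ?case using \<open>e > 0\<close> by (simp add: K_def)
    next
      case (step j)
      have lt: "M j < M (Suc j)"
        using \<open>strict_mono M\<close> by (simp add: strict_mono_Suc_iff)
      have "R j dvd M (Suc j) - M j"
        using dvd by (intro dvd_diff_nat)
      then obtain t where "M (Suc j) - M j = R j * t" ..
      then have t: "M (Suc j) = M j + t * R j"
        using lt by (simp add: mult.commute)
      have "\<bar>D (M (Suc j))\<bar> \<le> \<bar>D (M j)\<bar> + e * real (t * R j)"
        using eblocks[of j t] step t by simp
      then show ?case
        using step t by (simp add: algebra_simps)
    qed
    have bound: "\<bar>D N\<bar> \<le> K + 2 * e * real N" if "N \<ge> M j0" for N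
    proof -
      \<comment> \<open>Strict monotonicity gives \<open>M i \<ge> i\<close>, so the indices with
        \<open>M i \<le> N\<close> are bounded and a greatest one exists.\<close>
      define j where "j = (GREATEST j. M j \<le> N)"
      have le: "i \<le> N" if "M i \<le> N" for i
        using strict_mono_imp_increasing[OF \<open>strict_mono M\<close>, of i] that by simp
      have j: "M j \<le> N" "j0 \<le> j"
        unfolding j_def using that le
        by (auto intro: GreatestI_nat[of "\<lambda>j. M j \<le> N" j0 N] Greatest_le_nat[of "\<lambda>j. M j \<le> N" j0 N])
      have "\<not> M (Suc j) \<le> N"
      proof
        assume "M (Suc j) \<le> N"
        then have "Suc j \<le> j"
          unfolding j_def using le by (intro Greatest_le_nat) auto
        then show False
          by simp
      qed
      then have N: "N < M (Suc j)"
        by simp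
      define t where "t = (N - M j) div R j"
      define p where "p = (N - M j) mod R j"
      have Nt: "N = M j + t * R j + p"
        using j(1) by (simp add: t_def p_def)
      have p: "real p \<le> real (R j)"
        using R0[of j] by (simp add: p_def less_imp_le)
      have "\<bar>D N\<bar> \<le> \<bar>D (M j + t * R j)\<bar> + real p"
        using short[of "M j + t * R j" p] Nt by simp
      also have "\<dots> \<le> K + e * real (M j) + e * real (t * R j) + e * real (M j)"
        using eblocks[of j t] atM[of j] eM[of j] p j N Nt by simp
      also have "\<dots> \<le> K + 2 * e * real N"
      proof -
        have "e * real (M j + t * R j) \<le> e * real N" "e * real (M j) \<le> e * real N"
          using Nt \<open>e > 0\<close> by auto
        then show ?thesis
          by (simp add: algebra_simps)
      qed
      finally show ?thesis .
    qed
    \<comment> \<open>Beyond \<open>n0\<close> the constant \<open>K\<close> is below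
      \<open>e * N\<close>, so the error is below \<open>3 * e * N\<close>, which
      \<open>e = \<epsilon> / 4\<close> keeps under \<open>\<epsilon> * N\<close>.\<close>
    obtain n0 :: nat where n0: "K / e < real n0"
      using reals_Archimedean2 by blast
    have "norm (D N / real N - 0) < \<epsilon>" if "N \<ge> max (M j0) (Suc n0)" for N
    proof -
      have N: "real N > 0" "real N > real n0"
        using that by auto
      have "K / e < real N"
        using n0 N by linarith
      then have "K < e * real N"
        using \<open>e > 0\<close> by (simp add: pos_divide_less_eq mult.commute)
      then have "\<bar>D N\<bar> < 3 * e * real N"
        using bound[of N] that by simp
      also have "\<dots> \<le> \<epsilon> * real N"
        using \<open>\<epsilon> > 0\<close> N by (simp add: e_def)
      finally show ?thesis
        using N by (simp add: field_simps)
    qed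
    then show "\<exists>no. \<forall>n\<ge>no. norm (D n / real n - 0) < \<epsilon>"
      by blast
  qed
  then have "(\<lambda>N. D N / real N + b) \<longlonglongrightarrow> 0 + b"
    by (intro tendsto_intros)
  moreover have "\<forall>\<^sub>F N in sequentially. D N / real N + b = real (A N) / real N"
    using eventually_gt_at_top[of 0] by eventually_elim (simp add: D_def field_simps)
  ultimately have "(\<lambda>N. real (A N) / real N) \<longlonglongrightarrow> 0 + b"
    by (rule Lim_transform_eventually)
  then show ?thesis
    by (simp add: A_def)
qed

lemma uniformly_distributed_blocks:
  fixes y :: "nat \<Rightarrow> real" and M R :: "nat \<Rightarrow> nat"
  assumes y: "\<And>n. 0 \<le> y n" "\<And>n. y n < 1" and "strict_mono M"
    and "\<And>j n. M j \<le> n \<Longrightarrow> n < M (Suc j) \<Longrightarrow> \<lfloor>real (R j) * y n\<rfloor> = int ((n + d) mod R j)"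
    and "\<And>j. R j dvd M j" "\<And>j. R j dvd M (Suc j)"
    and "\<And>j. j < R j" "\<And>j. j * R j \<le> M j"
  shows "uniformly_distributed_mod1 y"
  unfolding uniformly_distributed_mod1_def
proof (intro allI impI)
  fix a b :: real
  assume ab: "0 \<le> a \<and> a < b \<and> b \<le> 1"
  have lim: "(\<lambda>N. real (card {n\<in>{..<N}. y n < c}) / real N) \<longlonglongrightarrow> c" if "0 \<le> c" "c \<le> 1" for c
    by (rule block_counting_limit[OF that assms(3-)])
  have "real (card {n \<in> {..<N}. frac (y n) \<in> {a..<b}}) =
      real (card {n\<in>{..<N}. y n < b}) - real (card {n\<in>{..<N}. y n < a})" for N
  proof -
    have "frac (y n) = y n" for n
      using y by (simp add: frac_eq)
    then have "{n \<in> {..<N}. frac (y n) \<in> {a..<b}} = {n\<in>{..<N}. y n < b} - {n\<in>{..<N}. y n < a}"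
      by auto
    moreover have "{n\<in>{..<N}. y n < a} \<subseteq> {n\<in>{..<N}. y n < b}"
      using ab by auto
    ultimately show ?thesis
      by (simp add: card_Diff_subset card_mono of_nat_diff)
  qed
  then show "(\<lambda>N. real (card {n \<in> {..<N}. frac (y n) \<in> {a..<b}}) / real N) \<longlonglongrightarrow> b - a"
    using tendsto_diff[OF lim[of b] lim[of a]] ab by (simp add: diff_divide_distrib)
qed

section \<open>The construction\<close>

locale theta_data =
  fixes Q s :: "nat \<Rightarrow> nat"
  assumes Q: "basic_seq Q" and s: "basic_seq s" and Q_lim: "infinite_in_limit Q"
begin

abbreviation "S \<equiv> theta_S s"
abbreviation "L \<equiv> theta_L Q s"
abbreviation "\<nu> \<equiv> theta_nu Q s"

section \<open>Growth and divisibility of \<open>S\<close>, \<open>\<nu>\<close> and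
  \<open>L\<close>\<close>

lemma S_1 [simp]: "S (Suc 0) = 1"
  by (simp add: theta_S_def)

lemma S_Suc: "1 \<le> j \<Longrightarrow> S (Suc j) = S j * s j"
  by (simp add: theta_S_def prod.atLeastLessThan_Suc)

lemma s_ge: "1 \<le> j \<Longrightarrow> 2 \<le> s j"
  using s by (simp add: basic_seq_def)

lemma S_dvd_add: "1 \<le> k \<Longrightarrow> S k dvd S (k + i)"
  by (induction i) (simp_all add: S_Suc)

lemma S_add_ge: "1 \<le> k \<Longrightarrow> S k * 2 ^ i \<le> S (k + i)"
proof (induction i)
  case (Suc i)
  then show ?case
    using mult_le_mono[of "S k * 2 ^ i" "S (k + i)" 2 "s (k + i)"] s_ge[of "k + i"]
    by (simp add: S_Suc mult_ac)
qed simp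

lemma S_ge: "i < j \<Longrightarrow> 2 ^ i \<le> S j"
  using S_add_ge[of 1 "j - 1"] power_increasing[of i "j - 1" "2::nat"]
  by (cases j) (simp_all del: power_increasing_iff)

lemma S_pos: "1 \<le> j \<Longrightarrow> 0 < S j"
  using S_ge[of 0 j] by simp

lemma nu_pos: "1 \<le> \<nu> j" and Q_ge_nu: "\<nu> j \<le> m \<Longrightarrow> S j ^ (2 * j) \<le> Q m"
proof -
  have "\<forall>\<^sub>F n in sequentially. S j ^ (2 * j) \<le> Q n"
    using Q_lim unfolding infinite_in_limit_def filterlim_at_top by blast
  then obtain N where "\<forall>m\<ge>N. S j ^ (2 * j) \<le> Q m"
    by (auto simp: eventually_sequentially)
  then have "max 1 N \<ge> 1 \<and> (\<forall>m\<ge>max 1 N. Q m \<ge> S j ^ (2 * j))"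
    by simp
  then have "\<nu> j \<ge> 1 \<and> (\<forall>m\<ge>\<nu> j. Q m \<ge> S j ^ (2 * j))"
    unfolding theta_nu_def by (rule LeastI)
  then show "1 \<le> \<nu> j" "\<nu> j \<le> m \<Longrightarrow> S j ^ (2 * j) \<le> Q m"
    by auto
qed

lemma L_0 [simp]: "L 0 = 0"
  by (simp add: theta_L_def)

lemma L_1: "L (Suc 0) = s 1 * \<nu> 2"
  by (simp add: theta_L_def)

lemma L_Suc: "L (Suc j) = L j + S (Suc j) * theta_l Q s (Suc j)"
  by (simp add: theta_L_def)

text \<open>Divisibility makes the \<open>div\<close> in \<open>theta_l\<close> exact. It stands as
  a hypothesis because its own proof by induction uses this product formula.\<close>

lemma L_Suc_Suc_if_dvd:
  assumes "S (n + 2) dvd L (Suc n)"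
  shows "L (n + 2) = L (Suc n) * (2 * (n + 2) * s (n + 2) * \<nu> (n + 3))"
proof -
  let ?c = "2 * (n + 2) * s (n + 2) * \<nu> (n + 3)"
  have "0 < ?c"
    using s_ge[of "n + 2"] nu_pos[of "n + 3"] by auto
  then have c: "?c = Suc (?c - 1)"
    by linarith
  have "theta_l Q s (n + 2) = L (Suc n) * (?c - 1) div S (n + 2)"
    unfolding theta_L_def by simp
  then have "S (n + 2) * theta_l Q s (n + 2) = L (Suc n) * (?c - 1)"
    using assms by (simp only: dvd_mult2 dvd_mult_div_cancel)
  then have "L (n + 2) = L (Suc n) * Suc (?c - 1)"
    using L_Suc[of "Suc n"] by simp
  then show ?thesis
    unfolding c[symmetric] .
qed

lemma S_dvd_L: "S (n + 2) dvd L (Suc n)"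
proof (induction n)
  case 0
  then show ?case
    using S_Suc[of 1] by (simp add: L_1 numeral_2_eq_2)
next
  case (Suc n)
  then have "S (n + 2) * s (n + 2) dvd L (n + 2)"
    unfolding L_Suc_Suc_if_dvd[OF Suc] by (intro mult_dvd_mono) auto
  then show ?case
    using S_Suc[of "n + 2"] by simp
qed

lemmas L_Suc_Suc = L_Suc_Suc_if_dvd[OF S_dvd_L]

text \<open>The period of a level is short compared with everything before that level, which later
  controls incomplete blocks. In the induction step the factor
  \<open>2 * (n + 2) * s (n + 2)\<close> supplies both the new \<open>s\<close> and the new linear
  factor.\<close>

lemma L_ge: "Suc n * S (n + 2) \<le> L (Suc n)"
proof (induction n)
  case 0
  then show ?case
    using S_Suc[of 1] nu_pos[of 2] by (simp add: L_1 numeral_2_eq_2)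
next
  case (Suc n)
  define X where "X = (n + 2) * (S (n + 2) * s (n + 2))"
  have "(n + 2) * S (n + 3) = X * 1"
    using S_Suc[of "n + 2"] by (simp add: X_def numeral_3_eq_3)
  also have "\<dots> \<le> X * (2 * Suc n)"
    by (rule mult_le_mono2) simp
  also have "\<dots> = Suc n * S (n + 2) * (2 * (n + 2) * s (n + 2) * 1)"
    by (simp only: X_def mult_ac mult_1_right)
  also have "\<dots> \<le> L (n + 2)"
    unfolding L_Suc_Suc using nu_pos[of "n + 3"] by (intro mult_le_mono Suc) auto
  finally show ?case
    by (simp add: numeral_3_eq_3)
qed

lemma L_pos: "0 < L (Suc n)"
  using L_ge[of n] S_pos[of "n + 2"] by (auto intro: less_le_trans)

text \<open>The factor \<open>\<nu> (n + 2)\<close> is built into \<open>L (Suc n)\<close>, so the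
  lower bound on \<open>Q\<close> attached to level \<open>n + 2\<close> already holds where that
  level starts.\<close>

lemma nu_le_L: "\<nu> (n + 2) \<le> L (Suc n)"
proof (cases n)
  case 0
  then show ?thesis
    using s_ge[of 1] by (simp add: L_1 numeral_2_eq_2)
next
  case (Suc k)
  have "1 * (1 * 1 * 1 * \<nu> (k + 3)) \<le> L (Suc k) * (2 * (k + 2) * s (k + 2) * \<nu> (k + 3))"
    using L_pos[of k] s_ge[of "k + 2"] by (intro mult_le_mono) simp_all
  also have "\<dots> = L (k + 2)"
    by (rule L_Suc_Suc[symmetric])
  finally show ?thesis
    using Suc by (simp add: numeral_3_eq_3)
qed

lemma strict_mono_L: "strict_mono L"
  unfolding strict_mono_Suc_iff
proof
  fix n
  show "L n < L (Suc n)"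
  proof (cases n)
    case 0
    then show ?thesis
      using L_pos[of 0] by simp
  next
    case (Suc k)
    have "2 * 1 * 1 * 1 \<le> 2 * (k + 2) * s (k + 2) * \<nu> (k + 3)"
      using s_ge[of "k + 2"] nu_pos[of "k + 3"] by (intro mult_le_mono) auto
    then have "L (Suc k) * 2 \<le> L (Suc k) * (2 * (k + 2) * s (k + 2) * \<nu> (k + 3))"
      by (intro mult_le_mono2) simp
    also have "\<dots> = L (k + 2)"
      by (rule L_Suc_Suc[symmetric])
    finally show ?thesis
      using Suc L_pos[of k] by simp
  qed
qed

lemma L_mono: "i \<le> j \<Longrightarrow> L i \<le> L j"
  using strict_mono_L by (simp add: strict_mono_less_eq)

text \<open>The exponent \<open>2 * (m + 2)\<close> is at least 4. A carry below
  \<open>2 / S ^ 4\<close> is then small against the window width \<open>1 / S ^ 2\<close>.\<close>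

lemma Q_large:
  assumes "L (Suc m) \<le> n"
  shows "S (m + 2) ^ 4 \<le> Q n"
proof -
  have "S (m + 2) ^ 4 \<le> S (m + 2) ^ (2 * (m + 2))"
    using S_pos[of "m + 2"] by (intro power_increasing) auto
  also have "\<dots> \<le> Q n"
    using Q_ge_nu[of "m + 2" n] nu_le_L[of m] assms by simp
  finally show ?thesis .
qed

lemma Q_ge_16:
  assumes "L (Suc 0) \<le> n"
  shows "16 \<le> Q n"
proof -
  have "2 ^ 4 \<le> S (0 + 2) ^ 4"
    using S_ge[of 1 2] by (intro power_mono) (simp_all add: numeral_2_eq_2)
  then show ?thesis
    using Q_large[of 0 n] assms by simp
qed

section \<open>Levels and the indexing \<open>theta_phi\<close>\<close>

lemma level_exists: "\<exists>m. L m \<le> i \<and> i < L (Suc m)"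
proof -
  define j where "j = (LEAST j. i < L j)"
  have "i < L (Suc i)"
    using strict_mono_imp_increasing[OF strict_mono_L, of "Suc i"] by simp
  then have j: "i < L j"
    unfolding j_def by (rule LeastI)
  then obtain m where m: "j = Suc m"
    by (cases j) auto
  then have "\<not> i < L m"
    using not_less_Least[of m "\<lambda>j. i < L j"] by (simp add: j_def)
  then show ?thesis
    using j m by (intro exI[of _ m]) auto
qed

text \<open>Indices are shifted by one: \<open>T i\<close> is governed by the numerator at
  \<open>Suc i\<close>, so level \<open>j\<close> is the range from \<open>L (j - 1)\<close> up to,
  but excluding, \<open>L j\<close>. Later levels are written \<open>j = m + 2\<close>.\<close>

lemma level_cases:
  obtains (first) "i < L (Suc 0)" | (later) m where "L (Suc m) \<le> i" "i < L (m + 2)"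
proof -
  obtain m where "L m \<le> i" "i < L (Suc m)"
    using level_exists by blast
  then show thesis
    using first later[of "m - 1"] by (cases m) auto
qed

lemma level_unique:
  assumes "L m \<le> i" "i < L (Suc m)" "L k \<le> i" "i < L (Suc k)"
  shows "m = k"
proof -
  have "\<not> m < k" "\<not> k < m"
    using assms L_mono[of "Suc m" k] L_mono[of "Suc k" m] by auto
  then show ?thesis
    by simp
qed

text \<open>For the residue: \<open>S j\<close> divides \<open>L (j - 1)\<close>, so the position is
  congruent to \<open>c\<close>; here \<open>c = S j\<close> stands for the residue 0.\<close>

lemma phi_level:
  assumes "(j, b, c) \<in> theta_U Q s"
  shows "L (j - 1) < theta_phi Q s (j, b, c)" "theta_phi Q s (j, b, c) \<le> L j"
    and "theta_phi Q s (j, b, c) mod S j = c mod S j"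
proof -
  have u: "1 \<le> j" "1 \<le> b" "1 \<le> c" "b \<le> theta_l Q s j" "c \<le> S j"
    using assms by (auto simp: theta_U_def)
  have phi: "theta_phi Q s (j, b, c) = L (j - 1) + (b - 1) * S j + c"
    by (simp add: theta_phi_def)
  show "L (j - 1) < theta_phi Q s (j, b, c)"
    using u phi by simp
  have "(b - 1) * S j + c \<le> (b - 1) * S j + S j"
    using u by simp
  also have "\<dots> = b * S j"
    using u by (cases b) auto
  also have "\<dots> \<le> theta_l Q s j * S j"
    using u by simp
  finally show "theta_phi Q s (j, b, c) \<le> L j"
    using u phi L_Suc[of "j - 1"] by (simp add: mult.commute)
  have "S j dvd L (j - 1)"
    using u S_dvd_L[of "j - 2"] by (cases "j = 1") (auto simp: Suc_diff_Suc numeral_2_eq_2)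
  then show "theta_phi Q s (j, b, c) mod S j = c mod S j"
    unfolding phi by (metis add.assoc dvd_def mod_mult_self1 mod_mult_self2 mult.commute add.commute)
qed

text \<open>Quotient and remainder of \<open>i - L m\<close> by \<open>S (Suc m)\<close> are
  \<open>b - 1\<close> and \<open>c - 1\<close>. Surjectivity makes \<open>inv_into\<close> in
  \<open>theta_E\<close> return an index in \<open>theta_U\<close>.\<close>

lemma phi_surj: "\<exists>u\<in>theta_U Q s. theta_phi Q s u = Suc i"
proof -
  obtain m where m: "L m \<le> i" "i < L (Suc m)"
    using level_exists by blast
  define p where "p = i - L m"
  have p: "p < S (Suc m) * theta_l Q s (Suc m)"
    using m L_Suc[of m] by (simp add: p_def)
  have "p div S (Suc m) < theta_l Q s (Suc m)"
    using p by (simp add: less_mult_imp_div_less mult.commute)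
  moreover have "p mod S (Suc m) < S (Suc m)"
    using S_pos[of "Suc m"] by simp
  ultimately have "(Suc m, Suc (p div S (Suc m)), Suc (p mod S (Suc m))) \<in> theta_U Q s"
    by (simp add: theta_U_def)
  moreover have "theta_phi Q s (Suc m, Suc (p div S (Suc m)), Suc (p mod S (Suc m))) = Suc i"
    using m div_mult_mod_eq[of p "S (Suc m)"] by (simp add: theta_phi_def p_def)
  ultimately show ?thesis
    by blast
qed

text \<open>For \<open>j > 1\<close> the window has length \<open>1 / S j ^ 2\<close>, at least the
  mesh \<open>1 / q\<close>, so rounding up the scaled left endpoint gives a numerator; for
  \<open>j = 1\<close> the numerator is 1. The resulting point is later shifted to prove
  strictness.\<close>

lemma theta_F_nonempty: "theta_F Q s \<noteq> {}"
proof -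
  have "\<exists>f\<ge>1. real f / real (Q (theta_phi Q s u)) \<in> theta_V Q s u" if u: "u \<in> theta_U Q s" for u
  proof -
    obtain j b c where [simp]: "u = (j, b, c)"
      by (cases u)
    define q where "q = Q (theta_phi Q s u)"
    have "1 \<le> theta_phi Q s u"
      using phi_level(1)[of j b c] u by simp
    then have q2: "2 \<le> q"
      using Q by (simp add: q_def basic_seq_def)
    show ?thesis
    proof (cases "j = 1")
      case True
      then have "real 1 / real (Q (theta_phi Q s u)) \<in> theta_V Q s u"
        using q2 by (simp add: theta_V_def q_def divide_strict_right_mono)
      then show ?thesis
        by blast
    next
      case False
      then obtain m where m: "j = m + 2"
        using u by (cases j; cases "j - 1") (auto simp: theta_U_def)
      have S0: "0 < S j"
        using m S_pos by simp
      have "S j ^ 2 \<le> S j ^ 4"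
        using S0 by (intro power_increasing) auto
      also have "\<dots> \<le> q"
        using phi_level(1)[of j b c] u m Q_large[of m] by (simp add: q_def)
      finally have q: "real (S j) ^ 2 \<le> real q"
        by (metis of_nat_le_iff of_nat_power)
      define a where "a = real q * (real c / real (S j) + 1 / real (S j) ^ 2)"
      have q1: "1 \<le> real q * (1 / real (S j) ^ 2)"
        using q S0 by simp
      have "0 < a"
        unfolding a_def using q2 S0 by (intro mult_pos_pos add_nonneg_pos) auto
      define f where "f = nat \<lceil>a\<rceil>"
      have f: "a \<le> real f" "real f < a + 1"
        using \<open>0 < a\<close> unfolding f_def by linarith+
      have f1: "1 \<le> f"
        using \<open>0 < a\<close> f by simp
      have up: "a + 1 \<le> real q * (real c / real (S j) + 2 / real (S j) ^ 2)"
      proof -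
        have "2 / real (S j) ^ 2 = 1 / real (S j) ^ 2 + 1 / real (S j) ^ 2"
          by simp
        then show ?thesis
          unfolding a_def using q1 by (simp only: distrib_left)
      qed
      have "real c / real (S j) + 1 / real (S j) ^ 2 \<le> real f / real q"
        using f(1) q2 by (simp add: a_def pos_le_divide_eq mult.commute)
      moreover have "real f / real q \<le> real c / real (S j) + 2 / real (S j) ^ 2"
        using f(2) up q2 by (simp add: pos_divide_le_eq mult.commute)
      ultimately have "real f / real (Q (theta_phi Q s u)) \<in> theta_V Q s u"
        using False by (simp add: theta_V_def q_def)
      then show ?thesis
        using f1 by blast
    qed
  qed
  then obtain F where "\<forall>u\<in>theta_U Q s. F u \<ge> 1 \<and> real (F u) / real (Q (theta_phi Q s u)) \<in> theta_V Q s u"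
    by metis
  then show ?thesis
    by (auto simp: theta_F_def)
qed

end

section \<open>Numerators and tails of a point of \<open>Theta\<close>\<close>

locale theta_point = theta_data +
  fixes F :: "nat \<times> nat \<times> nat \<Rightarrow> nat"
  assumes F: "F \<in> theta_F Q s"
begin

abbreviation "E \<equiv> theta_E Q s F"
abbreviation "x \<equiv> theta_x Q s F"
abbreviation "T i \<equiv> cantor_T Q i x"
abbreviation "r \<equiv> cantor_tail Q E x"

lemma E_eq:
  obtains j b c where "(j, b, c) \<in> theta_U Q s" "theta_phi Q s (j, b, c) = Suc i"
    "real (E (Suc i)) / real (Q (Suc i)) \<in> theta_V Q s (j, b, c)"
proof -
  define u where "u = inv_into (theta_U Q s) (theta_phi Q s) (Suc i)"
  have "Suc i \<in> theta_phi Q s ` theta_U Q s"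
    using phi_surj[of i] by force
  then have u: "u \<in> theta_U Q s" "theta_phi Q s u = Suc i"
    unfolding u_def by (simp_all add: inv_into_into f_inv_into_f)
  have "E (Suc i) = F u"
    by (simp add: theta_E_def u_def)
  then have "real (E (Suc i)) / real (Q (Suc i)) \<in> theta_V Q s u"
    using F u unfolding theta_F_def by force
  then show thesis
    using that u by (cases u) simp
qed

lemma level_eq:
  assumes "(j, b, c) \<in> theta_U Q s" "theta_phi Q s (j, b, c) = Suc i"
    and "L m \<le> i" "i < L (Suc m)"
  shows "j = Suc m"
proof -
  have "1 \<le> j"
    using assms(1) by (simp add: theta_U_def)
  then show ?thesis
    using phi_level(1,2)[OF assms(1)] assms level_unique[of m i "j - 1"] by simp
qed

lemma E_first: "i < L (Suc 0) \<Longrightarrow> E (Suc i) = 1"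
proof -
  assume i: "i < L (Suc 0)"
  obtain j b c where u: "(j, b, c) \<in> theta_U Q s" "theta_phi Q s (j, b, c) = Suc i"
    "real (E (Suc i)) / real (Q (Suc i)) \<in> theta_V Q s (j, b, c)"
    by (rule E_eq)
  have "j = 1"
    using level_eq[OF u(1,2), of 0] i by simp
  then have "1 / real (Q (Suc i)) \<le> real (E (Suc i)) / real (Q (Suc i))"
    "real (E (Suc i)) / real (Q (Suc i)) < 2 / real (Q (Suc i))"
    using u by (simp_all add: theta_V_def)
  then show ?thesis
    using basic_seq_Suc[OF Q, of i] by (simp add: divide_le_cancel divide_less_cancel)
qed

lemma E_later:
  assumes "L (Suc m) \<le> i" "i < L (m + 2)"
  obtains c where "1 \<le> c" "c \<le> S (m + 2)" "Suc i mod S (m + 2) = c mod S (m + 2)"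
    "real c / real (S (m + 2)) + 1 / real (S (m + 2)) ^ 2 \<le> real (E (Suc i)) / real (Q (Suc i))"
    "real (E (Suc i)) / real (Q (Suc i)) \<le> real c / real (S (m + 2)) + 2 / real (S (m + 2)) ^ 2"
proof -
  obtain j b c where u: "(j, b, c) \<in> theta_U Q s" "theta_phi Q s (j, b, c) = Suc i"
    "real (E (Suc i)) / real (Q (Suc i)) \<in> theta_V Q s (j, b, c)"
    by (rule E_eq)
  have j: "j = m + 2"
    using level_eq[OF u(1,2), of "Suc m"] assms by simp
  show thesis
  proof (rule that[of c])
    show "1 \<le> c" "c \<le> S (m + 2)"
      using u(1) j by (auto simp: theta_U_def)
    show "Suc i mod S (m + 2) = c mod S (m + 2)"
      using phi_level(3)[OF u(1)] u(2) j by simp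
  qed (use u(3) j in \<open>simp_all add: theta_V_def\<close>)
qed

lemma E_later_le:
  assumes "L (Suc 0) \<le> i"
  shows "real (E (Suc i)) \<le> 3 / 2 * real (Q (Suc i))"
proof -
  obtain m where m: "L (Suc m) \<le> i" "i < L (m + 2)"
    using assms by (cases i rule: level_cases) auto
  obtain c where c: "c \<le> S (m + 2)"
    "real (E (Suc i)) / real (Q (Suc i)) \<le> real c / real (S (m + 2)) + 2 / real (S (m + 2)) ^ 2"
    using E_later[OF m] by metis
  have S2: "2 \<le> real (S (m + 2))"
    using S_ge[of 1 "m + 2"] by simp
  have "real c / real (S (m + 2)) \<le> 1"
    using c(1) S2 by simp
  moreover have "2 / real (S (m + 2)) ^ 2 \<le> 2 / 2 ^ 2"
    using S2 by (intro divide_left_mono power_mono) auto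
  moreover have "(2::real) / 2 ^ 2 = 1 / 2"
    by simp
  ultimately have "real (E (Suc i)) / real (Q (Suc i)) \<le> 3 / 2"
    using c(2) by linarith
  then show ?thesis
    using basic_seq_Suc[OF Q, of i] by (simp add: pos_divide_le_eq)
qed

text \<open>The hypothesis of \<open>cantor_tail_bounds\<close> with \<open>K = 3\<close>: on later
  levels \<open>3 / 2 * q + 3 \<le> 3 * q\<close> is exactly \<open>q \<ge> 2\<close>.\<close>

lemma E_bound: "real (E (Suc i)) + 3 \<le> 3 * real (Q (Suc i))"
proof (cases "i < L (Suc 0)")
  case True
  then show ?thesis
    using E_first[of i] basic_seq_Suc[OF Q, of i] by simp
next
  case False
  then show ?thesis
    using E_later_le[of i] basic_seq_Suc[OF Q, of i] by simp
qed

lemma sums_x: "(\<lambda>n. real (E (Suc n)) / real (base_prod Q (Suc n))) sums x"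
proof -
  have "summable (\<lambda>n. real (E (Suc n)) / real (base_prod Q (Suc n)))"
    using summable_cantor_series[OF Q E_bound] by simp
  moreover have "x = (\<Sum>n. real (E (Suc n)) / real (base_prod Q (Suc n)))"
    by (simp only: theta_x_def base_prod_def)
  ultimately show ?thesis
    by (simp only: summable_sums)
qed

lemma r_nonneg: "0 \<le> r i" and r_le_3: "r i \<le> 3"
  using cantor_tail_bounds[OF Q E_bound _ sums_x] by simp_all

lemma x_le_3: "x \<le> 3"
  using r_le_3[of 0] by simp

lemma r_rec: "real (Q (Suc i)) * r i = real (E (Suc i)) + r (Suc i)"
  by (simp add: cantor_tail_Suc[OF Q])

lemma T_frac: "T i = frac (r i)"
  by (simp add: frac_cantor_tail[OF Q])

text \<open>Feeding the crude bound 3 back into the recursion improves it, since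
  \<open>q \<ge> 16\<close> beyond the first level.\<close>

lemma r_later_less_2:
  assumes "L (Suc 0) \<le> i"
  shows "r i < 2"
proof -
  have "16 \<le> real (Q (Suc i))"
    using Q_ge_16[of "Suc i"] assms by simp
  then have "real (Q (Suc i)) * r i < real (Q (Suc i)) * 2"
    using r_rec[of i] E_later_le[OF assms] r_le_3[of "Suc i"] by linarith
  then show ?thesis
    by (rule mult_left_less_imp_less) simp
qed

text \<open>Backward induction from the end of the first level: its numerators are all 1, and the
  tail after the last one is below 2.\<close>

lemma r_first_less_1: "i < L (Suc 0) \<Longrightarrow> r i < 1"
proof (induction "L (Suc 0) - i" arbitrary: i)
  case (Suc k)
  have rec: "real (Q (Suc i)) * r i = 1 + r (Suc i)"
    using r_rec[of i] E_first[OF Suc.prems] by simp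
  have "real (Q (Suc i)) * r i < real (Q (Suc i)) * 1"
  proof (cases "Suc i < L (Suc 0)")
    case True
    then have "r (Suc i) < 1"
      using Suc by simp
    then show ?thesis
      using rec basic_seq_Suc[OF Q, of i] by simp
  next
    case False
    then show ?thesis
      using rec r_later_less_2[of "Suc i"] Q_ge_16[of "Suc i"] by simp
  qed
  then show ?case
    by (rule mult_left_less_imp_less) simp
qed simp

lemma r_less_2: "r i < 2"
  using r_first_less_1[of i] r_later_less_2[of i] by (cases "i < L (Suc 0)") auto

text \<open>The tail exceeds \<open>c / \<sigma>\<close> by some \<open>z\<close> with
  \<open>1 / \<sigma> ^ 2 \<le> z\<close> and \<open>\<sigma> * z < 1\<close>. For
  \<open>c < S\<close> the tail stays below 1 and the floor is \<open>c\<close>; for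
  \<open>c = S\<close> it is \<open>1 + z\<close>, and removing the unit leaves the floor 0.\<close>

lemma T_block:
  assumes "L (Suc m) \<le> i" "i < L (m + 2)" "3 \<le> S (m + 2)"
  shows "\<lfloor>real (S (m + 2)) * T i\<rfloor> = int (Suc i mod S (m + 2))"
    and "1 / real (S (m + 2)) ^ 2 \<le> T i"
proof -
  define \<sigma> where "\<sigma> = real (S (m + 2))"
  define q where "q = real (Q (Suc i))"
  obtain c where c: "1 \<le> c" "c \<le> S (m + 2)" "Suc i mod S (m + 2) = c mod S (m + 2)"
    "real c / \<sigma> + 1 / \<sigma> ^ 2 \<le> real (E (Suc i)) / q"
    "real (E (Suc i)) / q \<le> real c / \<sigma> + 2 / \<sigma> ^ 2"
    using E_later[OF assms(1,2)] unfolding \<sigma>_def q_def by metis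
  have \<sigma>: "3 \<le> \<sigma>"
    using assms(3) by (simp add: \<sigma>_def)
  have "S (m + 2) ^ 4 \<le> Q (Suc i)"
    using Q_large[of m "Suc i"] assms(1) by simp
  then have q: "\<sigma> ^ 4 \<le> q"
    unfolding \<sigma>_def q_def by (metis of_nat_le_iff of_nat_power)
  have "0 < q"
    using basic_seq_Suc[OF Q, of i] by (simp add: q_def)
  define z where "z = r i - real c / \<sigma>"
  have "r i = real (E (Suc i)) / q + r (Suc i) / q"
    using r_rec[of i] \<open>0 < q\<close> by (simp add: q_def field_simps)
  then have z: "z = real (E (Suc i)) / q - real c / \<sigma> + r (Suc i) / q"
    by (simp add: z_def)
  have "0 \<le> r (Suc i) / q"
    using r_nonneg \<open>0 < q\<close> by simp
  then have z_ge: "1 / \<sigma> ^ 2 \<le> z"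
    using c(4) z by linarith
  have "r (Suc i) / q \<le> 2 / \<sigma> ^ 4"
    using q \<sigma> r_less_2[of "Suc i"] r_nonneg[of "Suc i"] by (intro frac_le) auto
  then have "z \<le> 2 / \<sigma> ^ 2 + 2 / \<sigma> ^ 4"
    using c(5) z by linarith
  then have "\<sigma> * z \<le> \<sigma> * (2 / \<sigma> ^ 2 + 2 / \<sigma> ^ 4)"
    using \<sigma> by (intro mult_left_mono) auto
  also have "\<dots> = 2 / \<sigma> + 2 / \<sigma> ^ 3"
    using \<sigma> by (simp add: field_simps power2_eq_square power3_eq_cube power4_eq_xxxx)
  \<comment> \<open>Here \<open>\<sigma> \<ge> 3\<close> enters: the bound is 20/27, whereas
    \<open>\<sigma> = 2\<close> would give 5/4.\<close>
  also have "\<dots> \<le> 2 / 3 + 2 / 3 ^ 3"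
    using \<sigma> by (intro add_mono divide_left_mono power_mono) auto
  finally have z_lt: "\<sigma> * z < 1"
    by simp
  have "0 < 1 / \<sigma> ^ 2"
    using \<sigma> by simp
  then have z0: "0 < z"
    using z_ge by linarith
  then have \<sigma>z0: "0 < \<sigma> * z"
    using \<sigma> by simp
  have \<sigma>r: "\<sigma> * r i = real c + \<sigma> * z"
    using \<sigma> by (simp add: z_def field_simps)
  have "\<lfloor>\<sigma> * T i\<rfloor> = int (c mod S (m + 2)) \<and> z \<le> T i"
  proof (cases "c < S (m + 2)")
    case True
    then have "real c + 1 \<le> \<sigma>"
      unfolding \<sigma>_def by (metis Suc_leI of_nat_Suc of_nat_le_iff add.commute)
    then have "\<sigma> * r i < \<sigma> * 1"
      using \<sigma>r z_lt by simp
    then have "r i < 1"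
      using \<sigma> by simp
    then have T: "T i = r i"
      using r_nonneg by (simp add: T_frac frac_eq)
    have "\<lfloor>real c + \<sigma> * z\<rfloor> = int c"
      using \<sigma>z0 z_lt by linarith
    moreover have "z \<le> r i"
      using \<sigma> by (simp add: z_def)
    ultimately show ?thesis
      using T \<sigma>r True by simp
  next
    case False
    then have cS: "c = S (m + 2)"
      using c(2) by simp
    then have r: "r i = z + 1"
      using \<sigma> by (simp add: z_def \<sigma>_def)
    have "1 * z \<le> \<sigma> * z"
      using \<sigma> z0 by (intro mult_right_mono) auto
    then have "z < 1"
      using z_lt by linarith
    then have "frac z = z"
      using z0 by (simp add: frac_eq)
    then have T: "T i = z"
      using frac_add_of_int[of z 1] by (simp add: T_frac r)
    have "\<lfloor>\<sigma> * z\<rfloor> = 0"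
      using \<sigma>z0 z_lt by linarith
    then show ?thesis
      using T cS by simp
  qed
  then show "\<lfloor>real (S (m + 2)) * T i\<rfloor> = int (Suc i mod S (m + 2))"
    and "1 / real (S (m + 2)) ^ 2 \<le> T i"
    using c(3) z_ge unfolding \<sigma>_def by simp_all
qed

section \<open>Sizes of \<open>Q (Suc i) * T i\<close> and the missing digits\<close>

lemma T_eq_minus_1: "1 \<le> r i \<Longrightarrow> T i = r i - 1"
proof -
  assume "1 \<le> r i"
  then have "frac (r i - 1) = r i - 1"
    using r_less_2[of i] by (simp add: frac_eq)
  then show ?thesis
    using frac_add_of_int[of "r i - 1" 1] by (simp add: T_frac)
qed

lemma T_eq_r: "r i < 1 \<Longrightarrow> T i = r i"
  using r_nonneg[of i] by (simp add: T_frac frac_eq)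

text \<open>
  If \<open>S 2 = 2\<close>, the window for \<open>c = 1\<close> on the second level reaches up to \<open>1\<close>, and the carry that
  always arrives from the next position can turn the digit into \<open>0\<close> or \<open>1\<close>.
\<close>

lemma scaled_T_exceptional:
  assumes "L (Suc 0) \<le> i" "i < L 2" "S 2 = 2"
  shows "4 \<le> real (Q (Suc i)) * T i \<or> 1 / 4 \<le> real (Q (Suc i)) * T i \<and> real (Q (Suc i)) * T i < 3"
proof -
  define q where "q = real (Q (Suc i))"
  define e where "e = real (E (Suc i))"
  define r' where "r' = r (Suc i)"
  have q16: "16 \<le> q"
    using Q_ge_16[of "Suc i"] assms(1) by (simp add: q_def)
  have r': "0 \<le> r'" "r' < 2"
    using r_nonneg r_less_2 by (simp_all add: r'_def)
  have rec: "q * r i = e + r'"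
    using r_rec[of i] by (simp add: q_def e_def r'_def)
  obtain c where c: "1 \<le> c" "c \<le> 2" "Suc i mod 2 = c mod 2"
    "real c / 2 + 1 / 4 \<le> e / q" "e / q \<le> real c / 2 + 1 / 2"
    using E_later[of 0 i] assms unfolding q_def e_def by (auto simp: numeral_2_eq_2[symmetric])
  have e: "(real c / 2 + 1 / 4) * q \<le> e" "e \<le> (real c / 2 + 1 / 2) * q"
    using c(4,5) q16 by (simp_all add: pos_le_divide_eq pos_divide_le_eq)
  consider "c = 1" | "c = 2"
    using c by linarith
  then show ?thesis
  proof cases
    case 1
    \<comment> \<open>The level ends at an even position, so after the odd position
      \<open>Suc i\<close> (where \<open>c = 1\<close>) comes another position of the same level,
      with \<open>c' = 2\<close>. Its numerator is at least 5/4 of its base, so the carry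
      \<open>r'\<close> is at least 5/4.\<close>
    have "even (L 2)"
      using S_dvd_L[of 1] S_dvd_add[of 2 1] assms(3) by (auto simp: numeral_2_eq_2 numeral_3_eq_3 intro: dvd_trans)
    moreover have "odd (Suc i)"
      using c(3) 1 by presburger
    ultimately have Suc_i: "Suc i < L 2"
      using assms(2) by (metis Suc_lessI)
    obtain c' where c': "1 \<le> c'" "c' \<le> 2" "Suc (Suc i) mod 2 = c' mod 2"
      "real c' / 2 + 1 / 4 \<le> real (E (Suc (Suc i))) / real (Q (Suc (Suc i)))"
      using E_later[of 0 "Suc i"] assms Suc_i by (auto simp: numeral_2_eq_2[symmetric])
    have "c' = 2"
      using c' \<open>odd (Suc i)\<close> by presburger
    moreover have q': "0 < real (Q (Suc (Suc i)))"
      using basic_seq_Suc[OF Q, of "Suc i"] by simp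
    ultimately have "5 / 4 * real (Q (Suc (Suc i))) \<le> real (E (Suc (Suc i)))"
      using c'(4) by (simp add: pos_le_divide_eq)
    then have "real (Q (Suc (Suc i))) * (5 / 4) \<le> real (Q (Suc (Suc i))) * r'"
      using r_rec[of "Suc i"] r_nonneg[of "Suc (Suc i)"] by (simp add: r'_def)
    then have r'54: "5 / 4 \<le> r'"
      using q' by simp
    \<comment> \<open>If \<open>e \<le> q - 2\<close>, nothing wraps around and
      \<open>q * T i \<ge> 3 / 4 * q\<close>. Otherwise \<open>e\<close> is at least
      \<open>q - 1\<close> and at most \<open>q\<close>; the carry pushes the tail past 1, leaving a
      value between \<open>5 / 4 - 1\<close> and 2.\<close>
    show ?thesis
    proof (cases "E (Suc i) + 2 \<le> Q (Suc i)")
      case True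
      then have "q * r i < q * 1"
        using rec r' by (simp add: q_def e_def)
      then have "T i = r i"
        using T_eq_r[of i] q16 by simp
      then have "q * T i = e + r'"
        using rec by simp
      then show ?thesis
        using e(1) q16 r' 1 unfolding q_def[symmetric] by simp
    next
      case False
      then have e1: "q - 1 \<le> e"
        by (simp add: q_def e_def)
      then have "q * 1 \<le> q * r i"
        using rec r'54 by simp
      then have "1 \<le> r i"
        using q16 by simp
      then have "q * T i = e + r' - q"
        using T_eq_minus_1[of i] rec by (simp add: right_diff_distrib)
      then show ?thesis
        using e(2) e1 r' r'54 1 unfolding q_def[symmetric] by simp
    qed
  next
    case 2
    \<comment> \<open>Now \<open>e \<ge> 5 / 4 * q\<close>: one unit is lost and at least
      \<open>q / 4 \<ge> 4\<close> remains.\<close>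
    have "q * 1 \<le> q * r i"
      using rec r' e(1) 2 q16 by simp
    then have "1 \<le> r i"
      using q16 by simp
    then have "q * T i = e + r' - q"
      using T_eq_minus_1[of i] rec by (simp add: right_diff_distrib)
    then show ?thesis
      using e(1) 2 q16 r' unfolding q_def[symmetric] by simp
  qed
qed

text \<open>The three ranges all avoid [3, 4). The bound \<open>16 \<le> Q (Suc (Suc i))\<close> in
  the exceptional case compensates for the weak lower bound 1/4 once two bases are
  multiplied.\<close>

lemma scaled_T_cases:
  obtains (first) "1 \<le> real (Q (Suc i)) * T i" "real (Q (Suc i)) * T i < 3"
  | (large) "4 \<le> real (Q (Suc i)) * T i"
  | (exceptional) "16 \<le> Q (Suc (Suc i))" "1 / 4 \<le> real (Q (Suc i)) * T i" "real (Q (Suc i)) * T i < 3"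
proof (cases i rule: level_cases)
  case first
  then have "real (Q (Suc i)) * T i = 1 + r (Suc i)"
    using T_eq_r[OF r_first_less_1] r_rec[of i] E_first[of i] by simp
  then show thesis
    using that(1) r_nonneg[of "Suc i"] r_less_2[of "Suc i"] by simp
next
  case (later m)
  have L1: "L (Suc 0) \<le> i"
    using L_mono[of "Suc 0" "Suc m"] later by simp
  show thesis
  proof (cases "3 \<le> S (m + 2)")
    case True
    have "S (m + 2) ^ 4 \<le> Q (Suc i)"
      using Q_large[of m "Suc i"] later by simp
    then have "real (S (m + 2)) ^ 4 \<le> real (Q (Suc i))"
      by (metis of_nat_le_iff of_nat_power)
    then have "real (S (m + 2)) ^ 4 * (1 / real (S (m + 2)) ^ 2) \<le> real (Q (Suc i)) * T i"
      using T_block(2)[OF later True] by (intro mult_mono) auto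
    moreover have "real (S (m + 2)) ^ 4 * (1 / real (S (m + 2)) ^ 2) = real (S (m + 2)) ^ 2"
      using True by (simp add: power2_eq_square power4_eq_xxxx)
    moreover have "3 ^ 2 \<le> real (S (m + 2)) ^ 2"
      using True by (intro power_mono) auto
    ultimately show thesis
      using that(2) by simp
  next
    case False
    \<comment> \<open>\<open>S 3 \<ge> 4\<close>, so a period below 3 occurs only on the second
      level, and there it equals 2.\<close>
    have "m = 0"
    proof (rule ccontr)
      assume "m \<noteq> 0"
      then show False
        using False S_ge[of 2 "m + 2"] by simp
    qed
    moreover have "S 2 = 2"
      using False S_ge[of 1 2] \<open>m = 0\<close> by (simp add: numeral_2_eq_2)
    ultimately show thesis
      using scaled_T_exceptional[of i] later that(2,3) Q_ge_16[of "Suc (Suc i)"] L1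
      by (auto simp: numeral_2_eq_2)
  qed
qed

lemma digit_not_3: "\<lfloor>real (Q (Suc i)) * T i\<rfloor> \<noteq> 3"
  by (cases i rule: scaled_T_cases) (auto simp: floor_eq_iff)

text \<open>For \<open>k \<ge> 2\<close> each entry of the \<open>k\<close>-th base sequence
  contains two consecutive entries of \<open>Q\<close>, so this bound rules out the digit 0
  there.\<close>

lemma scaled_T_two_ge_1: "1 \<le> real (Q (Suc i)) * real (Q (Suc (Suc i))) * T i"
proof -
  have *: "real (Q (Suc i)) * real (Q (Suc (Suc i))) * T i = real (Q (Suc (Suc i))) * (real (Q (Suc i)) * T i)"
    by simp
  have q2: "2 \<le> real (Q (Suc (Suc i)))"
    using basic_seq_Suc[OF Q, of "Suc i"] by simp
  show ?thesis
  proof (cases i rule: scaled_T_cases)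
    case first
    then have "2 * 1 \<le> real (Q (Suc (Suc i))) * (real (Q (Suc i)) * T i)"
      using q2 by (intro mult_mono) auto
    then show ?thesis
      unfolding * by linarith
  next
    case large
    then have "2 * 4 \<le> real (Q (Suc (Suc i))) * (real (Q (Suc i)) * T i)"
      using q2 by (intro mult_mono) auto
    then show ?thesis
      unfolding * by linarith
  next
    case exceptional
    then have "16 * (1 / 4) \<le> real (Q (Suc (Suc i))) * (real (Q (Suc i)) * T i)"
      by (intro mult_mono) auto
    then show ?thesis
      unfolding * by linarith
  qed
qed

text \<open>\<open>M\<close> and \<open>R\<close> are level ends and periods measured in units of
  \<open>S k\<close>. The index shift starts at level \<open>k + 2\<close>, so that
  \<open>S k\<close> divides all of them and every period is at least 4, as \<open>T_block\<close>
  demands.\<close>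

lemma uniformly_distributed_T:
  assumes "1 \<le> k"
  shows "uniformly_distributed_mod1 (\<lambda>n. T (S k * n))"
proof -
  define M where "M j = L (j + k + 1) div S k" for j
  define R where "R j = S (j + k + 2) div S k" for j
  have Sk: "0 < S k"
    using S_pos[OF assms] .
  have S_eq: "S (j + k + 2) = S k * R j" for j
    using S_dvd_add[OF assms, of "j + 2"] by (simp add: R_def add_ac)
  have "S k dvd L (j + k + 1)" for j
    using S_dvd_L[of "j + k"] S_eq[of j] by (auto intro: dvd_trans)
  then have L_eq: "L (j + k + 1) = S k * M j" for j
    by (simp add: M_def)
  \<comment> \<open>The offset is \<open>Suc (S k * n) div S k - n\<close>: it is 1 for
    \<open>k = 1\<close> and 0 for \<open>k \<ge> 2\<close>.\<close>
  show ?thesis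
  proof (rule uniformly_distributed_blocks[where M = M and R = R and d = "1 div S k"])
    show "0 \<le> T (S k * n)" "T (S k * n) < 1" for n
      by (rule cantor_T_range)+
    show "strict_mono M"
      unfolding strict_mono_Suc_iff
    proof
      fix j
      have "S k * M j < S k * M (Suc j)"
        using strict_mono_L L_eq[of j] L_eq[of "Suc j"] by (simp add: strict_mono_less flip: L_eq)
      then show "M j < M (Suc j)"
        by simp
    qed
    fix j
    show "R j dvd M j"
      using S_dvd_L[of "j + k"] S_eq[of j] L_eq[of j] Sk by simp
    show "R j dvd M (Suc j)"
    proof -
      have "S (j + k + 2) dvd L (Suc j + k + 1)"
        using S_dvd_L[of "Suc j + k"] S_dvd_add[of "j + k + 2" 1] by (auto intro: dvd_trans)
      then show ?thesis
        using S_eq[of j] L_eq[of "Suc j"] Sk by simp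
    qed
    have "S k * 2 ^ (j + 2) \<le> S k * R j"
      using S_add_ge[OF assms, of "j + 2"] S_eq[of j] by (simp add: add_ac)
    then have "2 ^ (j + 2) \<le> R j"
      using Sk by simp
    moreover have "j + 2 < 2 ^ (j + 2)"
      by (rule less_exp)
    ultimately show "j < R j"
      by linarith
    have "S k * (j * R j) = j * S (j + k + 2)"
      using S_eq[of j] by simp
    also have "\<dots> \<le> Suc (j + k) * S (j + k + 2)"
      by (intro mult_le_mono1) simp
    also have "\<dots> \<le> S k * M j"
      using L_ge[of "j + k"] L_eq[of j] by simp
    finally show "j * R j \<le> M j"
      using Sk by simp
  next
    fix j n
    assume n: "M j \<le> n" "n < M (Suc j)"
    define i where "i = S k * n"
    have i: "L (Suc (j + k)) \<le> i" "i < L (j + k + 2)"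
      using n L_eq[of j] L_eq[of "Suc j"] Sk by (simp_all add: i_def)
    have "3 \<le> S (j + k + 2)"
      using S_ge[of 2 "j + k + 2"] assms by simp
    then have *: "\<lfloor>real (S (j + k + 2)) * T i\<rfloor> = int (Suc i mod S (j + k + 2))"
      using T_block(1)[OF i] by simp
    \<comment> \<open>Division by \<open>S k\<close> passes through the floor and turns residues
      modulo \<open>S k * R j\<close> into residues modulo \<open>R j\<close>.\<close>
    have "real (R j) * T i = real (S (j + k + 2)) * T i / real (S k)"
      using S_eq[of j] Sk by simp
    then have "\<lfloor>real (R j) * T i\<rfloor> = \<lfloor>real (S (j + k + 2)) * T i\<rfloor> div int (S k)"
      using floor_divide_real_eq_div[of "int (S k)"] by simp
    also have "\<dots> = int (Suc i mod (S k * R j) div S k)"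
      unfolding * unfolding S_eq by (simp add: zdiv_int)
    also have "Suc i mod (S k * R j) div S k = Suc i div S k mod R j"
      using Sk by (simp add: mod_mult2_eq)
    also have "Suc i div S k = n + 1 div S k"
      using Sk div_mult_self2[of "S k" 1 n] by (simp add: i_def)
    finally show "\<lfloor>real (R j) * T (S k * n)\<rfloor> = int ((n + 1 div S k) mod R j)"
      by (simp add: i_def)
  qed
qed

end

section \<open>Passing to the bases \<open>Q\<^sub>j\<close>\<close>

lemma base_prod_block:
  assumes "base_sim t P Q"
  shows "base_prod Q n = base_prod P (t * n)"
proof (induction n)
  case (Suc n)
  have "base_prod P (m + k) = base_prod P m * (\<Prod>j=1..k. P (m + j))" for m k
    by (induction k) simp_all
  from this[of "t * n" t] show ?case
    using Suc assms by (simp add: base_sim_def add.commute)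
qed simp

locale theta_bases = theta_data +
  fixes Qs :: "nat \<Rightarrow> nat \<Rightarrow> nat"
  assumes Qs: "\<And>j. j \<ge> 1 \<Longrightarrow> basic_seq (Qs j)" and Qs_1: "Qs 1 = Q"
    and Qs_sim: "\<And>j. j \<ge> 1 \<Longrightarrow> base_sim (s j) (Qs j) (Qs (j + 1))"
begin

lemma base_prod_Qs: "1 \<le> k \<Longrightarrow> base_prod (Qs k) n = base_prod Q (S k * n)"
proof (induction k arbitrary: n rule: dec_induct)
  case base
  then show ?case
    using Qs_1 by simp
next
  case (step k)
  then show ?case
    using base_prod_block[OF Qs_sim[of k]] by (simp add: S_Suc mult_ac)
qed

lemma cantor_T_Qs: "1 \<le> k \<Longrightarrow> cantor_T (Qs k) n y = cantor_T Q (S k * n) y"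
  by (simp add: cantor_T_eq base_prod_Qs)

text \<open>The entry on the right is a product of \<open>S k \<ge> 2\<close> consecutive entries of
  \<open>Q\<close>, beginning with the two on the left.\<close>

lemma Qs_ge:
  assumes "2 \<le> k"
  shows "Q (Suc (S k * n)) * Q (Suc (Suc (S k * n))) \<le> Qs k (Suc n)"
proof -
  let ?i = "S k * n"
  have "2 \<le> S k"
    using assms S_ge[of 1 k] by simp
  then have "base_prod Q (Suc (Suc ?i)) \<le> base_prod Q (S k * Suc n)"
    by (intro base_prod_mono[OF Q]) simp
  also have "\<dots> = base_prod Q ?i * Qs k (Suc n)"
    using base_prod_Qs[of k "Suc n"] base_prod_Qs[of k n] assms by simp
  finally show ?thesis
    using base_prod_pos[OF Q, of ?i] by (simp add: mult.assoc)
qed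

text \<open>The shift \<open>a\<close> serves both halves of the theorem: \<open>a = 0\<close> gives
  the inclusion and \<open>a = 4\<close> a point outside \<open>Theta\<close>. Orbits, and hence
  digits, do not change under it.\<close>

lemma theta_x_shift_in:
  assumes "F \<in> theta_F Q s" "1 \<le> k"
  shows "theta_x Q s F + real a \<in> DN (Qs k) - RN1 (Qs k)"
proof -
  interpret theta_point Q s F
    using assms(1) by unfold_locales
  have T_eq: "cantor_T (Qs k) n (x + real a) = T (S k * n)" for n
    using assms(2) by (simp add: cantor_T_add_nat cantor_T_Qs)
  have digit: "cantor_digits (Qs k) (x + real a) (Suc n) = nat \<lfloor>real (Qs k (Suc n)) * T (S k * n)\<rfloor>" for n
    using cantor_digits_Suc[OF Qs[OF assms(2)]] T_eq by simp
  have "x + real a \<in> DN (Qs k)"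
    using uniformly_distributed_T[OF assms(2)] by (simp add: DN_def T_eq)
  moreover have "x + real a \<notin> RN1 (Qs k)"
  proof (cases "k = 1")
    case True
    show ?thesis
    proof (rule missing_digit_not_RN1)
      fix n
      show "cantor_digits (Qs k) (x + real a) (Suc n) \<noteq> 3"
        using digit[of n] digit_not_3[of n] True Qs_1 by auto
    qed
  next
    case False
    show ?thesis
    proof (rule missing_digit_not_RN1)
      fix n
      let ?i = "S k * n"
      have "1 \<le> real (Q (Suc ?i)) * real (Q (Suc (Suc ?i))) * T ?i"
        by (rule scaled_T_two_ge_1)
      also have "\<dots> \<le> real (Qs k (Suc n)) * T ?i"
      proof (rule mult_right_mono)
        show "real (Q (Suc ?i)) * real (Q (Suc (Suc ?i))) \<le> real (Qs k (Suc n))"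
          using Qs_ge[of k n] False assms(2) by (simp flip: of_nat_mult)
      qed (rule cantor_T_range)
      finally show "cantor_digits (Qs k) (x + real a) (Suc n) \<noteq> 0"
        using digit[of n] by simp
    qed
  qed
  ultimately show ?thesis
    by simp
qed

end

theorem corollary3p20:
  fixes Q s :: "nat \<Rightarrow> nat" and Qs :: "nat \<Rightarrow> nat \<Rightarrow> nat"
  assumes "basic_seq Q" and "basic_seq s" and "infinite_in_limit Q"
    and "\<And>j. j \<ge> 1 \<Longrightarrow> basic_seq (Qs j)"
    and "Qs 1 = Q"
    and "\<And>j. j \<ge> 1 \<Longrightarrow> base_sim (s j) (Qs j) (Qs (j + 1))"
  shows "Theta Q s \<subset> (\<Inter>j\<in>{1..}. DN (Qs j) - RN1 (Qs j))"
proof -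
  interpret theta_bases Q s Qs
    using assms by unfold_locales
  have sub: "Theta Q s \<subseteq> (\<Inter>j\<in>{1..}. DN (Qs j) - RN1 (Qs j))"
    using theta_x_shift_in[where a = 0] unfolding Theta_def by auto
  obtain F where F: "F \<in> theta_F Q s"
    using theta_F_nonempty by blast
  \<comment> \<open>All points of \<open>Theta\<close> lie in [0, 3], so a shift by 4 leaves the
    set.\<close>
  define y where "y = theta_x Q s F + real 4"
  have "0 \<le> theta_x Q s F"
  proof -
    interpret theta_point Q s F
      using F by unfold_locales
    show ?thesis
      using r_nonneg[of 0] by simp
  qed
  moreover have "y' \<le> 3" if y': "y' \<in> Theta Q s" for y'
  proof -
    obtain G where G: "G \<in> theta_F Q s" "y' = theta_x Q s G"
      using y' unfolding Theta_def by blast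
    interpret theta_point Q s G
      using G by unfold_locales
    show ?thesis
      using x_le_3 G by simp
  qed
  ultimately have "y \<notin> Theta Q s"
    by (force simp: y_def)
  moreover have "y \<in> (\<Inter>j\<in>{1..}. DN (Qs j) - RN1 (Qs j))"
    unfolding y_def using theta_x_shift_in[OF F, where a = 4] by (intro INT_I) simp
  ultimately show ?thesis
    using sub by blast
qed

end
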